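(* For every positive integer $n$: (i) $\mathrm{FixDim}(\mathrm{GL}(n,\mathbb{Z}))\ge n-2$; (ii) $\mathrm{FixDim}(\mathrm{SL}(n,\mathbb{Z}))\ge n-2$ if $n$ is odd; (iii) $\mathrm{FixDim}(\mathrm{SL}(n,\mathbb{Z}))\ge n-3$ if $n$ is even.
   Context: For a group $\Gamma$, $\mathrm{FixDim}(\Gamma)$ is defined by: $\mathrm{FixDim}(\Gamma)+1$ is the least integer $d$ such that $\Gamma$ admits a fixed-point-free action by isometries on a complete $\mathrm{CAT}(0)$ space of dimension $d$ (and $\mathrm{FixDim}(\Gamma)=\infty$ if there is no such $d$). Thus $\mathrm{FixDim}(\Gamma)\ge k$ means that $\Gamma$ has a fixed point whenever it acts by isometries on a complete $\mathrm{CAT}(0)$ space of dimension at most $k$. Actions are homomorphisms $\Gamma\to\mathrm{Isom}(X)$ (no semisimplicity or properness assumed); $\mathrm{CAT}(0)$ spaces are non-empty and not assumed locally compact. Dimension means topological covering dimension: $\dim(X)\le d$ if for every closed subspace $K\subseteq X$ and every $r\ge d$, every continuous map $K\to\mathbb{S}^r$ to the $r$-sphere extends to a continuous map $X\to\mathbb{S}^r$. *)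

theory Defs
  imports
    "HOL-Analysis.Analysis"
    "HOL-Algebra.Bij"
    "Jordan_Normal_Form.Determinant"
begin

section \<open>Complete CAT(0) spaces\<close>

definition geodesic_segment :: "'x metric \<Rightarrow> 'x \<Rightarrow> 'x \<Rightarrow> 'x set \<Rightarrow> bool" where
  "geodesic_segment m x y S \<longleftrightarrow>
     (\<exists>\<gamma> l. 0 \<le> l \<and> \<gamma> ` {0..l} \<subseteq> mspace m \<and> \<gamma> 0 = x \<and> \<gamma> l = y \<and>
        (\<forall>s\<in>{0..l}. \<forall>t\<in>{0..l}. mdist m (\<gamma> s) (\<gamma> t) = \<bar>s - t\<bar>) \<and>
        S = \<gamma> ` {0..(l::real)})"

definition geodesic_metric :: "'x metric \<Rightarrow> bool" where
  "geodesic_metric m \<longleftrightarrow> (\<forall>x\<in>mspace m. \<forall>y\<in>mspace m. \<exists>S. geodesic_segment m x y S)"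

text \<open>Triangles are indexed cyclically: the vertices are \<open>p 0\<close>, \<open>p 1\<close>, \<open>p 2\<close>, and the side \<open>S i\<close>
  is a chosen geodesic segment from \<open>p i\<close> to \<open>p ((i + 1) mod 3)\<close> (geodesics are not assumed to be
  unique).\<close>

definition geodesic_triangle :: "'x metric \<Rightarrow> (nat \<Rightarrow> 'x) \<Rightarrow> (nat \<Rightarrow> 'x set) \<Rightarrow> bool" where
  "geodesic_triangle m p S \<longleftrightarrow>
     (\<forall>i<3. p i \<in> mspace m \<and> geodesic_segment m (p i) (p (Suc i mod 3)) (S i))"

definition comparison_triangle :: "'x metric \<Rightarrow> (nat \<Rightarrow> 'x) \<Rightarrow> (nat \<Rightarrow> real^2) \<Rightarrow> bool" where
  "comparison_triangle m p q \<longleftrightarrow>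
     (\<forall>i<3. dist (q i) (q (Suc i mod 3)) = mdist m (p i) (p (Suc i mod 3)))"

definition comparison_point ::
  "'x metric \<Rightarrow> (nat \<Rightarrow> 'x) \<Rightarrow> (nat \<Rightarrow> real^2) \<Rightarrow> nat \<Rightarrow> 'x \<Rightarrow> real^2 \<Rightarrow> bool" where
  "comparison_point m p q i x x' \<longleftrightarrow>
     x' \<in> closed_segment (q i) (q (Suc i mod 3)) \<and> dist (q i) x' = mdist m (p i) x"

definition CAT0_inequality :: "'x metric \<Rightarrow> (nat \<Rightarrow> 'x) \<Rightarrow> (nat \<Rightarrow> 'x set) \<Rightarrow> bool" where
  "CAT0_inequality m p S \<longleftrightarrow>
     (\<forall>q. comparison_triangle m p q \<longrightarrow>
        (\<forall>i<3. \<forall>j<3. \<forall>x\<in>S i. \<forall>y\<in>S j. \<forall>x' y'.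
           comparison_point m p q i x x' \<and> comparison_point m p q j y y' \<longrightarrow>
           mdist m x y \<le> dist x' y'))"

definition CAT0_space :: "'x metric \<Rightarrow> bool" where
  "CAT0_space m \<longleftrightarrow>
     mspace m \<noteq> {} \<and> geodesic_metric m \<and>
     (\<forall>p S. geodesic_triangle m p S \<longrightarrow> CAT0_inequality m p S)"


section \<open>Covering dimension\<close>

definition covering_dim_le :: "'x topology \<Rightarrow> nat \<Rightarrow> bool" where
  "covering_dim_le X d \<longleftrightarrow>
     (\<forall>K r f. closedin X K \<and> d \<le> r \<and> continuous_map (subtopology X K) (nsphere r) f \<longrightarrow>
        (\<exists>g. continuous_map X (nsphere r) g \<and> (\<forall>x\<in>K. g x = f x)))"

text \<open>Natural numbers suffice for the dimension, because it is only used for non-empty spaces.\<close>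

definition has_covering_dim :: "'x topology \<Rightarrow> nat \<Rightarrow> bool" where
  "has_covering_dim X d \<longleftrightarrow> covering_dim_le X d \<and> (\<forall>d'<d. \<not> covering_dim_le X d')"


section \<open>Isometric actions and FixDim\<close>

definition isometry_group :: "'x metric \<Rightarrow> ('x \<Rightarrow> 'x) monoid" where
  "isometry_group m = BijGroup (mspace m)
     \<lparr>carrier := {f \<in> Bij (mspace m).
        \<forall>x\<in>mspace m. \<forall>y\<in>mspace m. mdist m (f x) (f y) = mdist m x y}\<rparr>"

definition fixed_point_free_action ::
  "('g, 'b) monoid_scheme \<Rightarrow> 'x metric \<Rightarrow> ('g \<Rightarrow> 'x \<Rightarrow> 'x) \<Rightarrow> bool" where
  "fixed_point_free_action \<Gamma> m \<phi> \<longleftrightarrow>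
     \<phi> \<in> hom \<Gamma> (isometry_group m) \<and> \<not> (\<exists>x\<in>mspace m. \<forall>g\<in>carrier \<Gamma>. \<phi> g x = x)"

text \<open>HOL cannot quantify over all types inside a formula, so the spaces considered are those whose
  points form a subset of an arbitrary type \<open>'x\<close>, passed as an explicit argument. A lower bound on
  \<open>FixDim\<close> in the unrestricted sense is the corresponding bound on \<open>FixDim TYPE('x) \<Gamma>\<close> for
  every \<open>'x\<close>.\<close>

definition has_fixed_point_free_action_dim ::
  "'x itself \<Rightarrow> ('g, 'b) monoid_scheme \<Rightarrow> nat \<Rightarrow> bool" where
  "has_fixed_point_free_action_dim _ \<Gamma> d \<longleftrightarrow>
     (\<exists>(m :: 'x metric) \<phi>. CAT0_space m \<and> mcomplete_of m \<and>
        has_covering_dim (mtopology_of m) d \<and> fixed_point_free_action \<Gamma> m \<phi>)"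

definition FixDim :: "'x itself \<Rightarrow> ('g, 'b) monoid_scheme \<Rightarrow> ereal" where
  "FixDim T \<Gamma> =
     (if \<exists>d. has_fixed_point_free_action_dim T \<Gamma> d
      then ereal (real (LEAST d. has_fixed_point_free_action_dim T \<Gamma> d) - 1)
      else \<infinity>)"


section \<open>The groups GL(n,Z) and SL(n,Z)\<close>

definition GL_int :: "nat \<Rightarrow> int mat monoid" where
  "GL_int n = units_of (ring_mat TYPE(int) n ())"

definition SL_int :: "nat \<Rightarrow> int mat monoid" where
  "SL_int n = GL_int n \<lparr>carrier := {A \<in> carrier (GL_int n). Determinant.det A = 1}\<rparr>"

end

theory Submission
  imports Defs "HOL-Homology.Homology"
begin

text \<open>
  Let \<open>X\<close> be a complete CAT(0) space of dimension at most \<open>d\<close>. The proof rests on a Helly theorem: if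
  \<open>d + 2\<close> closed convex subsets of \<open>X\<close> have the property that any \<open>d + 1\<close> of them have a common point,
  then all of them do (\<open>Helly\<close>). Fixed point sets of isometries are closed and convex, so an action of a
  group that is generated by \<open>d + 2\<close> subsets has a fixed point as soon as any \<open>d + 1\<close> of the subsets have
  a common fixed point. No semisimplicity is assumed, and elements of infinite order might well be
  parabolic; hence every fixed point comes ultimately from finite subgroups
  (\<open>finite_subgroup_has_fixed_point\<close>).

  Let \<open>n = d + 2\<close>. In GL(n,Z), the affine maps of \<open>\<int>\<^sup>n\<^sup>-\<^sup>1\<close> contain the affine Coxeter group of type \<open>C\<close>
  and rank \<open>n - 1\<close>. It is generated by \<open>n\<close> reflections, any \<open>n - 1\<close> of which generate a finite group. By
  Helly's theorem this infinite group has a fixed point. It contains a translation, that is, an elementary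
  matrix, and all elementary matrices are conjugate to it, so each of them has a fixed point
  (\<open>always_elliptic_elementary_GL_int\<close>). A unipotent group of triangular matrices is built from elementary
  matrices by successive normal extensions, and since a fixed point of a normalizing element can be
  projected to the fixed point set of the normalized group, it has a fixed point too
  (\<open>fixed_point_unipotent\<close>). Finally, SL(n,Z) is generated by the \<open>n\<close> elementary matrices along a cycle
  through all indices, and any \<open>n - 1\<close> of these lie in such a unipotent group. By Helly's theorem again,
  SL(n,Z) has a fixed point (\<open>SL_int_fixed_point\<close>), and then so does GL(n,Z).

  For odd \<open>n\<close>, SL(n,Z) is a quotient of GL(n,Z) and inherits the bound. For even \<open>n\<close>, the reflections
  are unavailable because they have determinant \<open>-1\<close>; elementary matrices are treated inside a copy of
  GL(n-1,Z) in SL(n,Z) instead, which costs one dimension.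
\<close>

section \<open>Convexity of the squared distance in CAT(0) spaces\<close>

lemma planar_triangle_exists:
  fixes a b c :: real
  assumes "0 \<le> a" "0 \<le> b" "0 \<le> c" "a \<le> b + c" "b \<le> a + c" "c \<le> a + b"
  shows "\<exists>q0 q1 q2 :: real^2. dist q0 q1 = a \<and> dist q1 q2 = b \<and> dist q2 q0 = c"
proof (cases "a = 0")
  case True
  with assms have "b = c" by linarith
  have "dist (0::real^2) (vector [c, 0]) = c"
    using assms by (simp add: dist_norm norm_vec_def L2_set_def sum_2)
  then have "dist (0::real^2) 0 = a \<and> dist (0::real^2) (vector [c, 0]) = b \<and> dist (vector [c, 0]) (0::real^2) = c"
    using True \<open>b = c\<close> by (simp add: dist_commute)
  then show ?thesis by blast
next
  case False
  with assms have a: "a > 0" by simp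
  define u where "u = (a\<^sup>2 + c\<^sup>2 - b\<^sup>2) / (2 * a)"
  have ua: "2 * a * u = a\<^sup>2 + c\<^sup>2 - b\<^sup>2" using a by (simp add: u_def)
  have "(c - u) * (2 * a) = (b - (a - c)) * (b + (a - c))"
    using ua by (simp add: algebra_simps power2_eq_square)
  moreover have "\<dots> \<ge> 0" using assms by (intro mult_nonneg_nonneg) auto
  ultimately have "c \<ge> u" using a by (metis diff_ge_0_iff_ge mult.commute zero_le_mult_iff mult_pos_pos not_less zero_less_numeral)
  have "(c + u) * (2 * a) = (a + c - b) * (a + c + b)"
    using ua by (simp add: algebra_simps power2_eq_square)
  moreover have "\<dots> \<ge> 0" using assms by (intro mult_nonneg_nonneg) auto
  ultimately have "0 \<le> c + u" using a by (metis mult.commute zero_le_mult_iff mult_pos_pos not_less zero_less_numeral)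
  have "u\<^sup>2 \<le> c\<^sup>2" using \<open>c \<ge> u\<close> \<open>0 \<le> c + u\<close> by (intro abs_le_square_iff[THEN iffD1]) auto
  define v where "v = sqrt (c\<^sup>2 - u\<^sup>2)"
  have v: "v\<^sup>2 = c\<^sup>2 - u\<^sup>2" using \<open>u\<^sup>2 \<le> c\<^sup>2\<close> by (simp add: v_def)
  let ?q1 = "vector [a, 0] :: real^2" and ?q2 = "vector [u, v] :: real^2"
  have "dist 0 ?q1 = a" using a by (simp add: dist_norm norm_vec_def L2_set_def sum_2)
  moreover have "dist ?q1 ?q2 = b"
  proof -
    have "(a - u)\<^sup>2 + v\<^sup>2 = b\<^sup>2" using v ua by (simp add: power2_diff)
    then show ?thesis using assms by (simp add: dist_norm norm_vec_def L2_set_def sum_2 power2_commute)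
  qed
  moreover have "dist ?q2 0 = c" using v assms by (simp add: dist_norm norm_vec_def L2_set_def sum_2)
  ultimately show ?thesis by blast
qed

lemma dist_division_point:
  fixes x y z :: "'a::real_inner"
  shows "(dist ((1 - s) *\<^sub>R y + s *\<^sub>R z) x)\<^sup>2
    = (1 - s) * (dist x y)\<^sup>2 + s * (dist x z)\<^sup>2 - s * (1 - s) * (dist y z)\<^sup>2"
  by (simp add: dist_norm power2_norm_eq_inner inner_diff inner_add algebra_simps inner_commute)

locale complete_CAT0 =
  fixes m :: "'x metric"
  assumes CAT0: "CAT0_space m" and complete: "mcomplete_of m"
begin

sublocale Metric_space "mspace m" "mdist m"
  by (rule Metric_space_mspace_mdist)

lemma mtopology_of_eq: "mtopology_of m = mtopology"
  by (simp add: mtopology_of_def)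

lemma mcomplete: mcomplete
  using complete by (simp add: mcomplete_of_def)

lemma nonempty: "mspace m \<noteq> {}"
  using CAT0 by (simp add: CAT0_space_def)

text \<open>The CAT(0) inequality is used in this form only: the squared distance to any point is as convex
  along a geodesic as it is in the plane. It is the comparison inequality between a vertex and a point
  of the opposite side.\<close>

lemma exists_division_point:
  assumes y: "y \<in> mspace m" and z: "z \<in> mspace m" and s: "0 \<le> s" "s \<le> 1"
  shows "\<exists>w\<in>mspace m. mdist m y w = s * mdist m y z \<and> mdist m w z = (1 - s) * mdist m y z \<and>
     (\<forall>x\<in>mspace m. (mdist m x w)\<^sup>2
        \<le> (1 - s) * (mdist m x y)\<^sup>2 + s * (mdist m x z)\<^sup>2 - s * (1 - s) * (mdist m y z)\<^sup>2)"
proof -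
  obtain S where S: "geodesic_segment m y z S"
    using CAT0 y z unfolding CAT0_space_def geodesic_metric_def by blast
  then obtain \<gamma> l where l: "0 \<le> l" and \<gamma>: "\<gamma> ` {0..l} \<subseteq> mspace m" "\<gamma> 0 = y" "\<gamma> l = z"
    and iso: "\<And>a b. a \<in> {0..l} \<Longrightarrow> b \<in> {0..l} \<Longrightarrow> mdist m (\<gamma> a) (\<gamma> b) = \<bar>a - b\<bar>"
    and S_eq: "S = \<gamma> ` {0..l}"
    unfolding geodesic_segment_def by blast
  have yz: "mdist m y z = l" using iso[of 0 l] l \<gamma> by auto
  define w where "w = \<gamma> (s * l)"
  have sl: "s * l \<in> {0..l}" using s l by (auto simp: mult_left_le_one_le)
  then have wS: "w \<in> S" and wX: "w \<in> mspace m" using \<gamma> by (auto simp: w_def S_eq)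
  have yw: "mdist m y w = s * l" using iso[of 0 "s * l"] sl l \<gamma> by (auto simp: w_def)
  have wz: "mdist m w z = (1 - s) * l" using iso[of "s * l" l] sl l \<gamma> by (auto simp: w_def algebra_simps)
  have "(mdist m x w)\<^sup>2 \<le> (1 - s) * (mdist m x y)\<^sup>2 + s * (mdist m x z)\<^sup>2 - s * (1 - s) * (mdist m y z)\<^sup>2"
    if x: "x \<in> mspace m" for x
  proof -
    obtain S1 where S1: "geodesic_segment m z x S1"
      using CAT0 x z unfolding CAT0_space_def geodesic_metric_def by blast
    obtain S2 where S2: "geodesic_segment m x y S2"
      using CAT0 x y unfolding CAT0_space_def geodesic_metric_def by blast
    have xS2: "x \<in> S2" using S2 unfolding geodesic_segment_def by force
    define p where "p = (\<lambda>i::nat. if i = 0 then y else if i = 1 then z else x)"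
    define T where "T = (\<lambda>i::nat. if i = 0 then S else if i = 1 then S1 else S2)"
    have lt3: "(\<forall>i<3. P i) \<longleftrightarrow> P 0 \<and> P 1 \<and> P 2" for P :: "nat \<Rightarrow> bool"
      by (simp add: eval_nat_numeral All_less_Suc) auto
    have tri: "geodesic_triangle m p T"
      unfolding geodesic_triangle_def lt3 using x y z S S1 S2 by (simp add: p_def T_def)
    obtain q0 q1 q2 :: "real^2" where q: "dist q0 q1 = mdist m y z" "dist q1 q2 = mdist m z x" "dist q2 q0 = mdist m x y"
      using planar_triangle_exists[of "mdist m y z" "mdist m z x" "mdist m x y"] x y z
        triangle[of y x z] triangle[of z y x] triangle[of x z y]
      by (auto simp: commute)
    define q where "q = (\<lambda>i::nat. if i = 0 then q0 else if i = 1 then q1 else q2)"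
    have cmp: "comparison_triangle m p q"
      unfolding comparison_triangle_def lt3 using q by (simp add: p_def q_def)
    let ?w = "(1 - s) *\<^sub>R q0 + s *\<^sub>R q1"
    have "?w \<in> closed_segment q0 q1" using s by (auto simp: closed_segment_def)
    moreover have "dist q0 ?w = s * l"
    proof -
      have "q0 - ?w = s *\<^sub>R (q0 - q1)" by (simp add: algebra_simps)
      then show ?thesis using q(1) yz s by (simp add: dist_norm)
    qed
    ultimately have cw: "comparison_point m p q 0 w ?w"
      unfolding comparison_point_def using yw by (simp add: p_def q_def)
    have cx: "comparison_point m p q 2 x q2"
      unfolding comparison_point_def using x by (simp add: p_def q_def)
    have "CAT0_inequality m p T"
      using CAT0 tri by (simp add: CAT0_space_def)
    then have "mdist m w x \<le> dist ?w q2"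
      using cmp cw cx wS xS2 unfolding CAT0_inequality_def lt3 by (auto simp: T_def)
    then have "(mdist m x w)\<^sup>2 \<le> (dist ?w q2)\<^sup>2"
      by (simp add: commute)
    then show ?thesis unfolding dist_division_point using q by (simp add: dist_commute commute)
  qed
  then have all: "\<forall>x\<in>mspace m. (mdist m x w)\<^sup>2
      \<le> (1 - s) * (mdist m x y)\<^sup>2 + s * (mdist m x z)\<^sup>2 - s * (1 - s) * (mdist m y z)\<^sup>2"
    by (rule ballI)
  have "mdist m y w = s * mdist m y z" "mdist m w z = (1 - s) * mdist m y z"
    using yw wz yz by simp_all
  with all wX show ?thesis by - (rule bexI[of _ w], rule conjI, assumption, rule conjI)
qed

text \<open>A point \<open>w\<close> that divides \<open>y, z\<close> in the ratio \<open>s : 1 - s\<close> satisfies the inequality even if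
  it is not known to lie on the chosen geodesic: applied to \<open>w\<close> itself, the inequality for the chosen
  division point \<open>v\<close> has right-hand side \<open>0\<close>, so \<open>w = v\<close>. This is the uniqueness of geodesics.\<close>

lemma division_point_inequality:
  assumes "x \<in> mspace m" "y \<in> mspace m" "z \<in> mspace m" "w \<in> mspace m" and s: "0 \<le> s" "s \<le> 1"
    and yw: "mdist m y w = s * mdist m y z" and wz: "mdist m w z = (1 - s) * mdist m y z"
  shows "(mdist m x w)\<^sup>2
        \<le> (1 - s) * (mdist m x y)\<^sup>2 + s * (mdist m x z)\<^sup>2 - s * (1 - s) * (mdist m y z)\<^sup>2"
proof -
  obtain v where v: "v \<in> mspace m" and ineq: "\<And>x. x \<in> mspace m \<Longrightarrow> (mdist m x v)\<^sup>2
        \<le> (1 - s) * (mdist m x y)\<^sup>2 + s * (mdist m x z)\<^sup>2 - s * (1 - s) * (mdist m y z)\<^sup>2"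
    using exists_division_point[of y z s] assms by blast
  have "(mdist m w v)\<^sup>2 \<le> 0"
    using ineq[OF \<open>w \<in> mspace m\<close>] yw wz by (simp add: commute[of w y] algebra_simps power2_eq_square)
  then have "w = v" using v assms by simp
  then show ?thesis using ineq assms by blast
qed

text \<open>Convexity is stated with metric intervals instead of geodesic paths, so that a set of fixed points
  can be shown convex by comparing distances alone.\<close>

definition geodesically_convex :: "'x set \<Rightarrow> bool" where
  "geodesically_convex C \<longleftrightarrow> C \<subseteq> mspace m \<and>
     (\<forall>y\<in>C. \<forall>z\<in>C. \<forall>w\<in>mspace m. mdist m y w + mdist m w z = mdist m y z \<longrightarrow> w \<in> C)"

definition closed_convex :: "'x set \<Rightarrow> bool" where
  "closed_convex C \<longleftrightarrow> closedin mtopology C \<and> geodesically_convex C"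

lemma geodesically_convex_subset: "geodesically_convex C \<Longrightarrow> C \<subseteq> mspace m"
  by (simp add: geodesically_convex_def)

lemma geodesically_convexD:
  "\<lbrakk>geodesically_convex C; y \<in> C; z \<in> C; w \<in> mspace m; mdist m y w + mdist m w z = mdist m y z\<rbrakk>
    \<Longrightarrow> w \<in> C"
  unfolding geodesically_convex_def by (elim conjE ballE impE) auto

lemma closed_convex_subset: "closed_convex C \<Longrightarrow> C \<subseteq> mspace m"
  by (simp add: closed_convex_def geodesically_convex_def)

lemma closed_convex_mspace: "closed_convex (mspace m)"
  by (simp add: closed_convex_def geodesically_convex_def)

definition energy :: "'i set \<Rightarrow> ('i \<Rightarrow> real) \<Rightarrow> ('i \<Rightarrow> 'x) \<Rightarrow> 'x \<Rightarrow> real" where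
  "energy I w p x = (\<Sum>i\<in>I. w i * (mdist m x (p i))\<^sup>2)"

text \<open>Uniform convexity of a weighted sum of squared distances.\<close>

lemma energy_division_point:
  assumes w: "\<And>i. i \<in> I \<Longrightarrow> 0 \<le> w i" "sum w I = 1" and p: "\<And>i. i \<in> I \<Longrightarrow> p i \<in> mspace m"
    and C: "geodesically_convex C" "y \<in> C" "z \<in> C" and s: "0 \<le> s" "s \<le> 1"
  shows "\<exists>v\<in>C. energy I w p v
    \<le> (1 - s) * energy I w p y + s * energy I w p z - s * (1 - s) * (mdist m y z)\<^sup>2"
proof -
  have yz: "y \<in> mspace m" "z \<in> mspace m" using C geodesically_convex_subset by auto
  obtain v where v: "v \<in> mspace m" "mdist m y v = s * mdist m y z" "mdist m v z = (1 - s) * mdist m y z"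
    and ineq: "\<And>x. x \<in> mspace m \<Longrightarrow> (mdist m x v)\<^sup>2
        \<le> (1 - s) * (mdist m x y)\<^sup>2 + s * (mdist m x z)\<^sup>2 - s * (1 - s) * (mdist m y z)\<^sup>2"
    using exists_division_point[OF yz s] by blast
  have "mdist m y v + mdist m v z = mdist m y z" using v by (simp add: algebra_simps)
  then have "v \<in> C" using geodesically_convexD[OF C] v by simp
  have "energy I w p v \<le> (\<Sum>i\<in>I. w i * ((1 - s) * (mdist m y (p i))\<^sup>2 + s * (mdist m z (p i))\<^sup>2
      - s * (1 - s) * (mdist m y z)\<^sup>2))"
    unfolding energy_def
  proof (intro sum_mono mult_left_mono)
    fix i assume "i \<in> I"
    then show "0 \<le> w i" "(mdist m v (p i))\<^sup>2 \<le> (1 - s) * (mdist m y (p i))\<^sup>2 + s * (mdist m z (p i))\<^sup>2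
      - s * (1 - s) * (mdist m y z)\<^sup>2"
      using w ineq[OF p[of i]] by (auto simp: commute)
  qed
  also have "\<dots> = (1 - s) * energy I w p y + s * energy I w p z - sum w I * (s * (1 - s) * (mdist m y z)\<^sup>2)"
    unfolding energy_def sum_distrib_left sum_distrib_right
    by (simp add: algebra_simps sum.distrib sum_subtractf)
  finally show ?thesis using \<open>v \<in> C\<close> w by auto
qed

text \<open>A minimizing sequence is Cauchy by uniform convexity, so a minimizer exists. The inequality
  \<open>f x + d(x,y)\<^sup>2 \<le> f y\<close> with constant \<open>1\<close> is obtained by comparing \<open>x\<close> with the point that divides
  \<open>x, y\<close> in the ratio \<open>s : 1 - s\<close> and letting \<open>s\<close> tend to \<open>0\<close>; the midpoint would only give the
  constant \<open>1/2\<close>, which is too weak to make projections contract distances. One lemma covers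
  projections (one point), circumcenters (an orbit, equal weights) and barycenters (arbitrary weights).\<close>

lemma energy_minimizer_exists:
  assumes "finite I" and w: "\<And>i. i \<in> I \<Longrightarrow> 0 \<le> w i" "sum w I = 1" and p: "\<And>i. i \<in> I \<Longrightarrow> p i \<in> mspace m"
    and C: "closed_convex C" "C \<noteq> {}"
  shows "\<exists>x\<in>C. \<forall>y\<in>C. energy I w p x + (mdist m x y)\<^sup>2 \<le> energy I w p y"
proof -
  let ?f = "energy I w p"
  have CX: "C \<subseteq> mspace m" and conv: "geodesically_convex C" and cl: "closedin mtopology C"
    using C(1) by (simp_all add: closed_convex_subset closed_convex_def)
  define \<mu> where "\<mu> = Inf (?f ` C)"
  have f0: "0 \<le> ?f x" for x unfolding energy_def using w by (intro sum_nonneg) auto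
  have bdd: "bdd_below (?f ` C)" using f0 by (intro bdd_belowI2)
  have \<mu>: "\<mu> \<le> ?f x" if "x \<in> C" for x unfolding \<mu>_def using that bdd by (auto intro: cInf_lower)
  have "\<exists>x\<in>C. ?f x < \<mu> + inverse (Suc k)" for k
  proof -
    have "Inf (?f ` C) < \<mu> + inverse (Suc k)" by (simp add: \<mu>_def)
    then show ?thesis using cInf_lessD[of "?f ` C"] C(2) by blast
  qed
  then obtain \<sigma> where \<sigma>: "\<And>k. \<sigma> k \<in> C" "\<And>k. ?f (\<sigma> k) < \<mu> + inverse (Suc k)" by metis
  have \<sigma>X: "\<sigma> k \<in> mspace m" for k using \<sigma> CX by auto
  have near: "(mdist m x y)\<^sup>2 \<le> 2 * (?f x - \<mu>) + 2 * (?f y - \<mu>)" if xy: "x \<in> C" "y \<in> C" for x y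
  proof -
    obtain v where "v \<in> C" "?f v \<le> (1 - 1/2) * ?f x + 1/2 * ?f y - 1/2 * (1 - 1/2) * (mdist m x y)\<^sup>2"
      using energy_division_point[of I w p C x y "1/2", OF w p conv xy] by auto
    with \<mu>[of v] show ?thesis by simp
  qed
  have lin: "D < E" if "D \<le> 2 * (a - \<mu>) + 2 * (b - \<mu>)" "a < \<mu> + u" "b < \<mu> + v" "u \<le> e" "v \<le> e" "4 * e < E"
    for D E a b u v e :: real
    using that by (simp add: algebra_simps)
  have "MCauchy \<sigma>"
    unfolding MCauchy_def
  proof (intro conjI allI impI)
    show "range \<sigma> \<subseteq> mspace m" using \<sigma>X by auto
    fix \<epsilon> :: real assume "\<epsilon> > 0"
    then obtain N where N: "inverse (real (Suc N)) < \<epsilon>\<^sup>2 / 4"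
      using reals_Archimedean[of "\<epsilon>\<^sup>2 / 4"] by auto
    show "\<exists>N. \<forall>n n'. N \<le> n \<longrightarrow> N \<le> n' \<longrightarrow> mdist m (\<sigma> n) (\<sigma> n') < \<epsilon>"
    proof (intro exI allI impI)
      fix n n' assume "N \<le> n" "N \<le> n'"
      then have "inverse (real (Suc n)) \<le> inverse (real (Suc N))" "inverse (real (Suc n')) \<le> inverse (real (Suc N))"
        by (auto intro: le_imp_inverse_le)
      then have "(mdist m (\<sigma> n) (\<sigma> n'))\<^sup>2 < \<epsilon>\<^sup>2"
        by (rule lin[OF near[OF \<sigma>(1)[of n] \<sigma>(1)[of n']] \<sigma>(2)[of n] \<sigma>(2)[of n']]) (use N in simp)
      then show "mdist m (\<sigma> n) (\<sigma> n') < \<epsilon>" using \<open>\<epsilon> > 0\<close> by (simp add: power_less_imp_less_base)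
    qed
  qed
  then obtain x where x: "limitin mtopology \<sigma> x sequentially"
    using mcomplete by (auto simp: mcomplete_def)
  then have xX: "x \<in> mspace m" and lim: "(\<lambda>k. mdist m (\<sigma> k) x) \<longlonglongrightarrow> 0"
    using limitin_metric_dist_null by auto
  have "x \<in> C"
    by (rule limitin_closedin[OF x cl]) (auto simp: \<sigma>)
  have "(\<lambda>k. ?f (\<sigma> k)) \<longlonglongrightarrow> ?f x"
    unfolding energy_def
  proof (intro tendsto_intros)
    fix i assume i: "i \<in> I"
    show "(\<lambda>k. mdist m (\<sigma> k) (p i)) \<longlonglongrightarrow> mdist m x (p i)"
    proof (rule LIM_zero_cancel, rule Lim_null_comparison[OF _ lim], intro always_eventually allI)
      fix k show "norm (mdist m (\<sigma> k) (p i) - mdist m x (p i)) \<le> mdist m (\<sigma> k) x"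
        using mdist_reverse_triangle[of "\<sigma> k" "p i" x] p[OF i] \<sigma>X xX by (simp add: commute)
    qed
  qed
  moreover have "(\<lambda>k. \<mu> + inverse (real (Suc k))) \<longlonglongrightarrow> \<mu> + 0"
    by (intro tendsto_intros LIMSEQ_inverse_real_of_nat)
  ultimately have fx: "?f x \<le> \<mu>"
    using LIMSEQ_le[of "\<lambda>k. ?f (\<sigma> k)" "?f x" "\<lambda>k. \<mu> + inverse (real (Suc k))" "\<mu> + 0"] \<sigma>(2)
    by (auto intro: less_imp_le)
  have "?f x + (mdist m x y)\<^sup>2 \<le> ?f y" if yC: "y \<in> C" for y
  proof -
    have "(mdist m x y)\<^sup>2 \<le> ?f y - ?f x"
    \<comment> \<open>below, \<open>t = 1 - s\<close> for the division ratio \<open>s\<close>\<close>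
    proof (rule field_le_mult_one_interval)
      fix t :: real assume t: "0 < t" "t < 1"
      obtain v where "v \<in> C" "?f v \<le> (1 - (1 - t)) * ?f x + (1 - t) * ?f y - (1 - t) * (1 - (1 - t)) * (mdist m x y)\<^sup>2"
        using energy_division_point[of I w p C x y "1 - t", OF w p conv \<open>x \<in> C\<close> yC] t by auto
      moreover have "?f x \<le> ?f v" using fx \<mu>[OF \<open>v \<in> C\<close>] by simp
      ultimately have "(1 - t) * (t * (mdist m x y)\<^sup>2) \<le> (1 - t) * (?f y - ?f x)"
        by (simp add: algebra_simps)
      then show "t * (mdist m x y)\<^sup>2 \<le> ?f y - ?f x" using t by simp
    qed
    then show ?thesis by simp
  qed
  then show ?thesis using \<open>x \<in> C\<close> by blast
qed

lemma projection_exists: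
  assumes C: "closed_convex C" "C \<noteq> {}" and x: "x \<in> mspace m"
  shows "\<exists>y\<in>C. \<forall>c\<in>C. (mdist m x y)\<^sup>2 + (mdist m y c)\<^sup>2 \<le> (mdist m x c)\<^sup>2"
  using energy_minimizer_exists[of "{()}" "\<lambda>_. 1" "\<lambda>_. x", OF _ _ _ _ C] x
  by (simp add: energy_def commute)


section \<open>Barycentric simplices\<close>

lemma barycenter_exists:
  assumes p: "\<And>i. i \<le> N \<Longrightarrow> p i \<in> mspace m" and w: "w \<in> standard_simplex N"
  shows "\<exists>x\<in>mspace m. \<forall>y\<in>mspace m. energy {..N} w p x + (mdist m x y)\<^sup>2 \<le> energy {..N} w p y"
  using w p by (intro energy_minimizer_exists closed_convex_mspace nonempty) (auto simp: standard_simplex_def)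

text \<open>The barycenter map sends a simplex continuously into the space and sends each face into every closed
  convex set that contains the vertices of that face. It replaces the iterated geodesic coning by which
  singular simplices are usually spanned in a CAT(0) space.\<close>

definition barycenter :: "nat \<Rightarrow> (nat \<Rightarrow> 'x) \<Rightarrow> (nat \<Rightarrow> real) \<Rightarrow> 'x" where
  "barycenter N p w = (SOME x. x \<in> mspace m \<and>
     (\<forall>y\<in>mspace m. energy {..N} w p x + (mdist m x y)\<^sup>2 \<le> energy {..N} w p y))"

context
  fixes N :: nat and p :: "nat \<Rightarrow> 'x"
  assumes p: "\<And>i. i \<le> N \<Longrightarrow> p i \<in> mspace m"
begin

lemma barycenter_works:
  assumes "w \<in> standard_simplex N"
  shows "barycenter N p w \<in> mspace m \<and> (\<forall>y\<in>mspace m.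
    energy {..N} w p (barycenter N p w) + (mdist m (barycenter N p w) y)\<^sup>2 \<le> energy {..N} w p y)"
  unfolding barycenter_def
  by (rule someI_ex) (use barycenter_exists[OF p assms] in \<open>simp add: Bex_def\<close>)

lemmas barycenter_in_mspace = barycenter_works[THEN conjunct1]
lemmas barycenter_variance = barycenter_works[THEN conjunct2, rule_format]

text \<open>Projecting the barycenter to the convex set does not increase its distance to any point that has
  positive weight, so the projection is a minimizer too.\<close>

lemma barycenter_in_closed_convex:
  assumes w: "w \<in> standard_simplex N" and C: "closed_convex C"
    and pC: "\<And>i. i \<le> N \<Longrightarrow> w i \<noteq> 0 \<Longrightarrow> p i \<in> C"
  shows "barycenter N p w \<in> C"
proof -
  let ?b = "barycenter N p w"
  have bX: "?b \<in> mspace m" by (rule barycenter_in_mspace[OF w])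
  have "C \<noteq> {}"
  proof
    assume "C = {}"
    then have "(\<Sum>i\<le>N. w i) = 0" using pC by (intro sum.neutral) auto
    then show False using w by (simp add: standard_simplex_def)
  qed
  then obtain y where y: "y \<in> C" and proj: "\<And>c. c \<in> C \<Longrightarrow> (mdist m ?b y)\<^sup>2 + (mdist m y c)\<^sup>2 \<le> (mdist m ?b c)\<^sup>2"
    using projection_exists[OF C _ bX] by blast
  have yX: "y \<in> mspace m" using y closed_convex_subset[OF C] by auto
  have "energy {..N} w p y \<le> energy {..N} w p ?b"
    unfolding energy_def
  proof (rule sum_mono)
    fix i assume i: "i \<in> {..N}"
    show "w i * (mdist m y (p i))\<^sup>2 \<le> w i * (mdist m ?b (p i))\<^sup>2"
    proof (cases "w i = 0")
      case False
      with i have "p i \<in> C" using pC by simp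
      then have "(mdist m y (p i))\<^sup>2 \<le> (mdist m ?b (p i))\<^sup>2"
        using proj[of "p i"] zero_le_power2[of "mdist m ?b y"] by linarith
      then show ?thesis using w by (intro mult_left_mono) (auto simp: standard_simplex_def)
    qed simp
  qed
  with barycenter_variance[OF w yX] have "(mdist m ?b y)\<^sup>2 \<le> 0" by linarith
  then have "?b = y" using bX yX by simp
  then show ?thesis using y by simp
qed

text \<open>Adding the variance inequalities of the barycenters \<open>a\<close>, \<open>b\<close> for two weights \<open>v\<close>, \<open>w\<close> bounds
  \<open>d(a,b)\<^sup>2\<close> by a multiple of \<open>\<Sum>i. \<bar>w i - v i\<bar>\<close>.\<close>

lemma continuous_map_barycenter:
  "continuous_map (subtopology (powertop_real UNIV) (standard_simplex N)) mtopology (barycenter N p)"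
  unfolding continuous_map_to_metric topspace_standard_simplex
proof (intro ballI allI impI)
  let ?\<Delta> = "subtopology (powertop_real UNIV) (standard_simplex N)"
  fix v and \<epsilon> :: real
  assume v: "v \<in> standard_simplex N" and \<epsilon>: "0 < \<epsilon>"
  define R where "R = (\<Sum>j\<le>N. \<Sum>i\<le>N. (mdist m (p j) (p i))\<^sup>2)"
  have bound: "(mdist m (barycenter N p w) (p j))\<^sup>2 \<le> R" if w: "w \<in> standard_simplex N" and j: "j \<le> N" for w j
  proof -
    have "0 \<le> energy {..N} w p (barycenter N p w)"
      unfolding energy_def using w by (intro sum_nonneg) (auto simp: standard_simplex_def)
    then have "(mdist m (barycenter N p w) (p j))\<^sup>2 \<le> energy {..N} w p (p j)"
      using barycenter_variance[OF w p[OF j]] by linarith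
    also have "\<dots> \<le> (\<Sum>i\<le>N. (mdist m (p j) (p i))\<^sup>2)"
      unfolding energy_def using w
      by (intro sum_mono mult_left_le_one_le) (auto simp: standard_simplex_def)
    also have "\<dots> \<le> R"
      unfolding R_def using j by (intro member_le_sum) (auto intro: sum_nonneg)
    finally show ?thesis .
  qed
  have close: "(mdist m (barycenter N p v) (barycenter N p w))\<^sup>2 \<le> (\<Sum>i\<le>N. \<bar>w i - v i\<bar> * R)"
    if w: "w \<in> standard_simplex N" for w
  proof -
    let ?a = "barycenter N p v" and ?b = "barycenter N p w"
    have ab: "?a \<in> mspace m" "?b \<in> mspace m" using barycenter_in_mspace v w by auto
    have "2 * (mdist m ?a ?b)\<^sup>2 \<le> energy {..N} v p ?b - energy {..N} v p ?a + (energy {..N} w p ?a - energy {..N} w p ?b)"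
      using barycenter_variance[OF v ab(2)] barycenter_variance[OF w ab(1)] by (simp add: commute)
    also have "\<dots> = (\<Sum>i\<le>N. (w i - v i) * ((mdist m ?a (p i))\<^sup>2 - (mdist m ?b (p i))\<^sup>2))"
      unfolding energy_def by (simp add: algebra_simps sum.distrib sum_subtractf)
    also have "\<dots> \<le> (\<Sum>i\<le>N. \<bar>w i - v i\<bar> * R)"
    proof (rule sum_mono)
      fix i assume "i \<in> {..N}"
      then have "(mdist m ?a (p i))\<^sup>2 \<le> R" "(mdist m ?b (p i))\<^sup>2 \<le> R"
        using bound[OF v, of i] bound[OF w, of i] by auto
      then have "\<bar>(mdist m ?a (p i))\<^sup>2 - (mdist m ?b (p i))\<^sup>2\<bar> \<le> R"
        using zero_le_power2[of "mdist m ?a (p i)"] zero_le_power2[of "mdist m ?b (p i)"]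
        by linarith
      then have "\<bar>(w i - v i) * ((mdist m ?a (p i))\<^sup>2 - (mdist m ?b (p i))\<^sup>2)\<bar> \<le> \<bar>w i - v i\<bar> * R"
        unfolding abs_mult by (intro mult_left_mono) auto
      then show "(w i - v i) * ((mdist m ?a (p i))\<^sup>2 - (mdist m ?b (p i))\<^sup>2) \<le> \<bar>w i - v i\<bar> * R"
        by linarith
    qed
    finally show ?thesis using zero_le_power2[of "mdist m ?a ?b"] by linarith
  qed
  define U where "U = {w \<in> topspace ?\<Delta>. (\<Sum>i\<le>N. \<bar>w i - v i\<bar> * R) \<in> {..<\<epsilon>\<^sup>2}}"
  have proj: "continuous_map ?\<Delta> euclideanreal (\<lambda>w. w i)" for i
    by (intro continuous_map_from_subtopology continuous_map_product_projection) simp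
  have "continuous_map ?\<Delta> euclideanreal (\<lambda>w. \<Sum>i\<le>N. \<bar>w i - v i\<bar> * R)"
    by (intro continuous_map_sum continuous_map_real_mult continuous_map_real_abs continuous_map_diff proj) auto
  then have "openin ?\<Delta> U"
    unfolding U_def by (rule openin_continuous_map_preimage) auto
  moreover have "v \<in> U" using v \<epsilon> by (simp add: U_def)
  moreover have "barycenter N p w \<in> mball (barycenter N p v) \<epsilon>" if "w \<in> U" for w
  proof -
    have w: "w \<in> standard_simplex N" and "(\<Sum>i\<le>N. \<bar>w i - v i\<bar> * R) < \<epsilon>\<^sup>2"
      using that by (auto simp: U_def)
    with close[OF w] have "(mdist m (barycenter N p v) (barycenter N p w))\<^sup>2 < \<epsilon>\<^sup>2" by linarith
    then have "mdist m (barycenter N p v) (barycenter N p w) < \<epsilon>" using \<epsilon> by (simp add: power_less_imp_less_base)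
    then show ?thesis using barycenter_in_mspace v w by simp
  qed
  ultimately show "\<exists>U. openin ?\<Delta> U \<and> v \<in> U \<and> (\<forall>w\<in>U. barycenter N p w \<in> mball (barycenter N p v) \<epsilon>)"
    by blast
qed

end

end

section \<open>Maps between spheres and simplices\<close>

definition unit_vector :: "nat \<Rightarrow> (nat \<Rightarrow> real) \<Rightarrow> nat \<Rightarrow> real" where
  "unit_vector d v = (\<lambda>i. if i \<le> d then v i / sqrt (\<Sum>j\<le>d. (v j)\<^sup>2) else 0)"

lemma unit_vector_nsphere:
  assumes "y \<in> topspace (nsphere d)"
  shows "unit_vector d y = y"
  using assms by (auto simp: unit_vector_def nsphere fun_eq_iff)

lemma continuous_map_unit_vector:
  assumes V: "\<And>i. i \<le> d \<Longrightarrow> continuous_map T euclideanreal (\<lambda>x. V x i)"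
    and nz: "\<And>x. x \<in> topspace T \<Longrightarrow> \<exists>i\<le>d. V x i \<noteq> 0"
  shows "continuous_map T (nsphere d) (\<lambda>x. unit_vector d (V x))"
proof -
  have pos: "(\<Sum>j\<le>d. (V x j)\<^sup>2) > 0" if x: "x \<in> topspace T" for x
  proof -
    obtain i where "i \<le> d" "V x i \<noteq> 0" using nz[OF x] by blast
    then show ?thesis by (intro sum_pos2[where i = i]) simp_all
  qed
  have "continuous_map T euclideanreal (\<lambda>x. unit_vector d (V x) i)" for i
  proof (cases "i \<le> d")
    case True
    have sq: "continuous_map T euclideanreal (\<lambda>x. sqrt (\<Sum>j\<le>d. (V x j)\<^sup>2))"
      by (intro continuous_map_sqrt continuous_map_sum continuous_map_real_pow V) auto
    have "sqrt (\<Sum>j\<le>d. (V x j)\<^sup>2) \<noteq> 0" if "x \<in> topspace T" for x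
      using pos[OF that] by simp
    with True show ?thesis
      unfolding unit_vector_def by (simp add: continuous_map_real_divide[OF V[OF True] sq])
  qed (simp add: unit_vector_def)
  moreover have "(\<Sum>i\<le>d. (unit_vector d (V x) i)\<^sup>2) = 1" if "x \<in> topspace T" for x
  proof -
    have "(\<Sum>i\<le>d. (unit_vector d (V x) i)\<^sup>2) = (\<Sum>i\<le>d. (V x i)\<^sup>2 / (\<Sum>j\<le>d. (V x j)\<^sup>2))"
      using less_imp_le[OF pos[OF that]] by (intro sum.cong) (simp_all add: unit_vector_def power_divide)
    then show ?thesis using pos[OF that] by (simp flip: sum_divide_distrib)
  qed
  moreover have "unit_vector d (V x) i = 0" if "i > d" for x i
    using that by (simp add: unit_vector_def)
  ultimately show ?thesis
    unfolding nsphere continuous_map_in_subtopology continuous_map_componentwise_UNIV by blast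
qed

lemma contractible_space_standard_simplex:
  "contractible_space (subtopology (powertop_real UNIV) (standard_simplex N))"
proof -
  let ?\<Delta> = "subtopology (powertop_real UNIV) (standard_simplex N)"
  let ?e = "\<lambda>j. if j = 0 then 1 else (0::real)"
  let ?h = "\<lambda>(t::real, x). (\<lambda>i. (1 - t) * x i + t * ?e i)"
  have "continuous_map (prod_topology (top_of_set {0..1}) ?\<Delta>) euclideanreal (\<lambda>z. snd z i)" for i
    by (rule continuous_map_compose[OF continuous_map_snd, of ?\<Delta> euclideanreal "\<lambda>x. x i", unfolded o_def])
       (intro continuous_map_from_subtopology continuous_map_product_projection, simp)
  moreover have "continuous_map (prod_topology (top_of_set {0..1}) ?\<Delta>) euclideanreal (\<lambda>z. fst z)"
    by (rule continuous_map_into_fulltopology[OF continuous_map_fst])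
  ultimately have "continuous_map (prod_topology (top_of_set {0..1}) ?\<Delta>) (powertop_real UNIV) ?h"
    unfolding continuous_map_componentwise_UNIV case_prod_unfold
    by (intro allI continuous_intros) auto
  moreover have "?h z \<in> standard_simplex N" if "z \<in> {0..1} \<times> standard_simplex N" for z
    using that convex_standard_simplex[of "snd z" N ?e "fst z"] by (auto simp: case_prod_unfold)
  ultimately have "continuous_map (prod_topology (top_of_set {0..1}) ?\<Delta>) ?\<Delta> ?h"
    by (auto simp: continuous_map_in_subtopology)
  then have "homotopic_with (\<lambda>x. True) ?\<Delta> ?\<Delta> id (\<lambda>x. ?e)"
    unfolding homotopic_with_def by (intro exI[of _ ?h]) auto
  then show ?thesis unfolding contractible_space_def by blast
qed

lemma continuous_map_Min:
  assumes "finite I" "I \<noteq> {}" and "\<And>i. i \<in> I \<Longrightarrow> continuous_map T euclideanreal (\<lambda>x. f x i)"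
  shows "continuous_map T euclideanreal (\<lambda>x. Min ((\<lambda>i. f x i) ` I) :: real)"
  using assms
proof (induction rule: finite_ne_induct)
  case (insert i I)
  then have "continuous_map T euclideanreal (\<lambda>x. min (f x i) (Min ((\<lambda>i. f x i) ` I)))"
    by (intro continuous_map_real_min) auto
  then show ?case using insert by simp
qed simp

text \<open>The map identifies the \<open>d\<close>-sphere with the boundary of the simplex on \<open>{0..d+1}\<close>: as
  \<open>y (d + 1) = 0\<close> on the sphere, subtracting the least coordinate of \<open>y\<close> gives nonnegative weights,
  one of which vanishes, and \<open>y i\<close> is recovered up to scaling as the \<open>i\<close>-th weight minus the last one.\<close>

definition sphere_to_simplex :: "nat \<Rightarrow> (nat \<Rightarrow> real) \<Rightarrow> nat \<Rightarrow> real" where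
  "sphere_to_simplex d y = (let u = (\<lambda>i. y i - Min (y ` {..Suc d})) in
     (\<lambda>i. if i \<le> Suc d then u i / (\<Sum>j\<le>Suc d. u j) else 0))"

lemma sphere_to_simplex:
  assumes y: "y \<in> topspace (nsphere d)"
  obtains s where "s > 0" and "\<And>i. i \<le> Suc d \<Longrightarrow> sphere_to_simplex d y i \<ge> 0"
    and "\<And>i. i \<le> d \<Longrightarrow> y i = s * (sphere_to_simplex d y i - sphere_to_simplex d y (Suc d))"
    and "sphere_to_simplex d y \<in> standard_simplex (Suc d)"
    and "\<exists>i\<le>Suc d. sphere_to_simplex d y i = 0"
    and "s = (\<Sum>j\<le>Suc d. y j - Min (y ` {..Suc d}))"
proof -
  define \<mu> where "\<mu> = Min (y ` {..Suc d})"
  define s where "s = (\<Sum>j\<le>Suc d. y j - \<mu>)"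
  have b: "sphere_to_simplex d y i = (if i \<le> Suc d then (y i - \<mu>) / s else 0)" for i
    by (simp add: sphere_to_simplex_def \<mu>_def s_def Let_def)
  have \<mu>: "\<mu> \<le> y i" if "i \<le> Suc d" for i unfolding \<mu>_def using that by (intro Min_le) auto
  have "\<mu> \<in> y ` {..Suc d}" unfolding \<mu>_def by (intro Min_in) auto
  then obtain i0 where i0: "i0 \<le> Suc d" "\<mu> = y i0" by auto
  have ySuc: "y (Suc d) = 0" and norm: "(\<Sum>i\<le>d. (y i)\<^sup>2) = 1" using y by (auto simp: nsphere)
  have "s \<noteq> 0"
  proof
    assume "s = 0"
    then have "\<forall>j\<in>{..Suc d}. y j - \<mu> = 0"
      unfolding s_def using \<mu> by (subst (asm) sum_nonneg_eq_0_iff) auto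
    then have "\<forall>j\<le>Suc d. y j = y (Suc d)" by auto
    then have "(\<Sum>i\<le>d. (y i)\<^sup>2) = 0" using ySuc by (intro sum.neutral) auto
    then show False using norm by simp
  qed
  moreover have "s \<ge> 0" unfolding s_def using \<mu> by (intro sum_nonneg) auto
  ultimately have s: "s > 0" by simp
  have sum1: "(\<Sum>i\<le>Suc d. sphere_to_simplex d y i) = 1"
  proof -
    have "(\<Sum>i\<le>Suc d. sphere_to_simplex d y i) = (\<Sum>i\<le>Suc d. (y i - \<mu>) / s)"
      by (intro sum.cong) (auto simp: b)
    also have "\<dots> = s / s" unfolding s_def sum_divide_distrib ..
    finally show ?thesis using s by simp
  qed
  have nn: "sphere_to_simplex d y i \<ge> 0" for i using \<mu> s by (auto simp: b)
  have "sphere_to_simplex d y i \<le> 1" for i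
  proof (cases "i \<le> Suc d")
    case True
    then have "sphere_to_simplex d y i \<le> (\<Sum>i\<le>Suc d. sphere_to_simplex d y i)"
      using nn by (intro member_le_sum) auto
    then show ?thesis using sum1 by simp
  qed (simp add: b)
  then have "sphere_to_simplex d y \<in> standard_simplex (Suc d)"
    using nn sum1 unfolding standard_simplex_def by (auto simp: b)
  moreover have "y i = s * (sphere_to_simplex d y i - sphere_to_simplex d y (Suc d))" if "i \<le> d" for i
    using that s ySuc by (simp add: b field_simps)
  moreover have "\<exists>i\<le>Suc d. sphere_to_simplex d y i = 0" using i0 by (auto simp: b)
  ultimately show ?thesis using that[of s] s nn unfolding s_def \<mu>_def by blast
qed

lemma continuous_map_sphere_to_simplex:
  "continuous_map (nsphere d) (subtopology (powertop_real UNIV) (standard_simplex (Suc d))) (sphere_to_simplex d)"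
proof -
  have pr: "continuous_map (nsphere d) euclideanreal (\<lambda>y. y i)" for i
    by (rule continuous_map_nsphere_projection)
  have mn: "continuous_map (nsphere d) euclideanreal (\<lambda>y. Min (y ` {..Suc d}))"
    by (rule continuous_map_Min) (auto intro: pr)
  have "continuous_map (nsphere d) euclideanreal (\<lambda>y. sphere_to_simplex d y i)" for i
  proof (cases "i \<le> Suc d")
    case True
    have nz: "(\<Sum>j\<le>Suc d. y j - Min (y ` {..Suc d})) \<noteq> 0" if "y \<in> topspace (nsphere d)" for y
      using sphere_to_simplex[OF that] by (metis less_irrefl)
    have sm: "continuous_map (nsphere d) euclideanreal (\<lambda>y. \<Sum>j\<le>Suc d. y j - Min (y ` {..Suc d}))"
      by (rule continuous_map_sum[OF finite_atMost continuous_map_diff[OF pr mn]])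
    show ?thesis unfolding sphere_to_simplex_def Let_def using True
      by (simp only: if_True) (rule continuous_map_real_divide[OF continuous_map_diff[OF pr mn] sm nz])
  qed (simp add: sphere_to_simplex_def Let_def)
  moreover have "sphere_to_simplex d y \<in> standard_simplex (Suc d)" if "y \<in> topspace (nsphere d)" for y
    using sphere_to_simplex[OF that] by metis
  ultimately show ?thesis
    by (simp add: continuous_map_in_subtopology continuous_map_componentwise_UNIV Pi_iff)
qed

section \<open>A Helly theorem in terms of covering dimension\<close>

lemma covering_dim_le_mono: "covering_dim_le X d \<Longrightarrow> d \<le> e \<Longrightarrow> covering_dim_le X e"
  unfolding covering_dim_le_def by (meson order_trans)

context complete_CAT0
begin

lemma distance_to_closed_convex_exists:
  assumes C: "closed_convex C" "C \<noteq> {}"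
  shows "\<exists>f. continuous_map mtopology euclideanreal f \<and> (\<forall>x\<in>mspace m. 0 \<le> f x \<and> (f x = 0 \<longleftrightarrow> x \<in> C))"
proof -
  have CX: "C \<subseteq> mspace m" by (rule closed_convex_subset[OF C(1)])
  have "\<forall>x\<in>mspace m. \<exists>y\<in>C. \<forall>c\<in>C. mdist m x y \<le> mdist m x c"
  proof
    fix x assume x: "x \<in> mspace m"
    obtain y where y: "y \<in> C" "\<And>c. c \<in> C \<Longrightarrow> (mdist m x y)\<^sup>2 + (mdist m y c)\<^sup>2 \<le> (mdist m x c)\<^sup>2"
      using projection_exists[OF C x] by blast
    have "mdist m x y \<le> mdist m x c" if "c \<in> C" for c
    proof (rule power2_le_imp_le)
      show "(mdist m x y)\<^sup>2 \<le> (mdist m x c)\<^sup>2"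
        using y(2)[OF that] zero_le_power2[of "mdist m y c"] by linarith
    qed simp
    then show "\<exists>y\<in>C. \<forall>c\<in>C. mdist m x y \<le> mdist m x c" using y(1) by blast
  qed
  then obtain \<pi> where \<pi>: "\<And>x. x \<in> mspace m \<Longrightarrow> \<pi> x \<in> C"
    and least: "\<And>x c. x \<in> mspace m \<Longrightarrow> c \<in> C \<Longrightarrow> mdist m x (\<pi> x) \<le> mdist m x c"
    by metis
  define f where "f x = mdist m x (\<pi> x)" for x
  have lip: "f x \<le> f y + mdist m x y" if xy: "x \<in> mspace m" "y \<in> mspace m" for x y
  proof -
    have "f x \<le> mdist m x (\<pi> y)" unfolding f_def using least \<pi> xy by blast
    also have "\<dots> \<le> mdist m x y + mdist m y (\<pi> y)" using xy \<pi> CX by (intro triangle) auto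
    finally show ?thesis by (simp add: f_def)
  qed
  have "continuous_map mtopology euclideanreal f"
    unfolding mtopology_is_euclidean[symmetric]
  proof (subst metric_continuous_map[OF Met_TC.Metric_space_axioms], intro conjI ballI allI impI)
    fix a and \<epsilon> :: real assume a: "a \<in> mspace m" and \<epsilon>: "\<epsilon> > 0"
    show "\<exists>\<delta>>0. \<forall>x. x \<in> mspace m \<and> mdist m a x < \<delta> \<longrightarrow> dist (f a) (f x) < \<epsilon>"
    proof (intro exI[of _ \<epsilon>] conjI allI impI \<epsilon>)
      fix x assume "x \<in> mspace m \<and> mdist m a x < \<epsilon>"
      then show "dist (f a) (f x) < \<epsilon>"
        using lip[of a x] lip[of x a] a by (auto simp: dist_real_def commute)
    qed
  qed auto
  moreover have "f x = 0 \<longleftrightarrow> x \<in> C" if "x \<in> mspace m" for x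
  proof
    assume "f x = 0"
    then have "x = \<pi> x" using that \<pi>[OF that] CX by (auto simp: f_def)
    then show "x \<in> C" using \<pi>[OF that] by simp
  next
    assume "x \<in> C"
    then show "f x = 0" using least[OF that, of x] that nonneg[of x "\<pi> x"] by (simp add: f_def)
  qed
  moreover have "0 \<le> f x" for x by (simp add: f_def)
  ultimately show ?thesis by blast
qed

text \<open>Suppose that the sets \<open>C 0, \<dots>, C (d + 1)\<close> have no common point, and let \<open>p k\<close> lie in all of them
  except possibly \<open>C k\<close>. Let \<open>f i\<close> be the distance to \<open>C i\<close>. On the union \<open>K\<close> of the sets some \<open>f i\<close>
  vanishes but not all do, so the vector with entries \<open>f i - f (d + 1)\<close> is nonzero, and normalizing it
  gives a map from \<open>K\<close> to the \<open>d\<close>-sphere. By the dimension hypothesis it extends to a map \<open>G\<close> on the whole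
  space. The boundary of the simplex spanned by the points \<open>p k\<close> lies in \<open>K\<close>, because the face opposite to
  \<open>p i\<close> lies in \<open>C i\<close>. Hence \<open>G\<close> restricted to this boundary sphere is homotopic to the identity by a
  straight line: both maps take the face opposite to \<open>p i\<close> to vectors whose \<open>i\<close>-th coordinate is zero.
  But it is also null-homotopic, since the barycenter map is defined on the whole simplex. This
  contradicts the fact that spheres are not contractible.\<close>

theorem Helly:
  assumes dim: "covering_dim_le mtopology d"
    and C: "\<And>i. i \<le> Suc d \<Longrightarrow> closed_convex (C i)"
    and meet: "\<And>k. k \<le> Suc d \<Longrightarrow> \<exists>x\<in>mspace m. \<forall>i\<le>Suc d. i \<noteq> k \<longrightarrow> x \<in> C i"
  shows "\<exists>x\<in>mspace m. \<forall>i\<le>Suc d. x \<in> C i"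
proof (rule ccontr)
  assume "\<not> ?thesis"
  then have empty: "\<exists>i\<le>Suc d. x \<notin> C i" if "x \<in> mspace m" for x using that by blast
  have "\<exists>p. \<forall>k\<le>Suc d. p k \<in> mspace m \<and> (\<forall>i\<le>Suc d. i \<noteq> k \<longrightarrow> p k \<in> C i)"
    using meet by (intro choice) (metis)
  then obtain p where pX: "\<And>k. k \<le> Suc d \<Longrightarrow> p k \<in> mspace m"
    and pC: "\<And>k i. k \<le> Suc d \<Longrightarrow> i \<le> Suc d \<Longrightarrow> i \<noteq> k \<Longrightarrow> p k \<in> C i" by blast
  have "C i \<noteq> {}" if "i \<le> Suc d" for i
    using pC[of 1 i] pC[of 0 i] that by (cases "i = 0") auto
  then have "\<exists>f. \<forall>i\<le>Suc d. continuous_map mtopology euclideanreal (f i) \<and>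
      (\<forall>x\<in>mspace m. 0 \<le> f i x \<and> (f i x = (0::real) \<longleftrightarrow> x \<in> C i))"
    using distance_to_closed_convex_exists C by (intro choice) metis
  then obtain f :: "nat \<Rightarrow> 'x \<Rightarrow> real" where f: "\<And>i. i \<le> Suc d \<Longrightarrow> continuous_map mtopology euclideanreal (f i)"
    and f_nn: "\<And>i x. i \<le> Suc d \<Longrightarrow> x \<in> mspace m \<Longrightarrow> 0 \<le> f i x"
    and f_0: "\<And>i x. i \<le> Suc d \<Longrightarrow> x \<in> mspace m \<Longrightarrow> f i x = 0 \<longleftrightarrow> x \<in> C i"
    by blast
  define V where "V x i = f i x - f (Suc d) x" for x i
  have V: "continuous_map mtopology euclideanreal (\<lambda>x. V x i)" if "i \<le> Suc d" for i
    unfolding V_def using f that by (intro continuous_intros) auto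
  define K where "K = (\<Union>i\<le>Suc d. C i)"
  have K: "closedin mtopology K"
    unfolding K_def using C by (intro closedin_Union) (auto simp: closed_convex_def)
  have KX: "K \<subseteq> mspace m" unfolding K_def using C closed_convex_subset by blast
  \<comment> \<open>The vectors on the straight line from \<open>u\<close> to \<open>f\<close> have a vanishing coordinate \<open>i0\<close>, so their
    difference vectors can vanish only if all their coordinates do.\<close>
  have nz: "\<exists>i\<le>d. (1 - t) * y i + t * V x i \<noteq> 0"
    if x: "x \<in> mspace m" and t: "0 \<le> t" "t \<le> 1" and u0: "\<And>i. i \<le> Suc d \<Longrightarrow> 0 \<le> u i"
      and yu: "\<And>i. i \<le> d \<Longrightarrow> y i = u i - u (Suc d)"
      and unz: "t < 1 \<Longrightarrow> \<exists>i\<le>Suc d. u i \<noteq> 0" and i0: "i0 \<le> Suc d" "u i0 = 0" "x \<in> C i0"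
    for x t y i0 and u :: "nat \<Rightarrow> real"
  proof (rule ccontr)
    assume neg: "\<not> ?thesis"
    define g where "g i = (1 - t) * u i + t * f i x" for i
    have "g i = g (Suc d)" if "i \<le> Suc d" for i
    proof (cases "i \<le> d")
      case True
      then have "(1 - t) * (u i - u (Suc d)) + t * (f i x - f (Suc d) x) = 0"
        using neg yu by (auto simp: V_def)
      then show ?thesis by (simp add: g_def algebra_simps)
    qed (use that in \<open>simp add: le_Suc_eq\<close>)
    moreover have "g i0 = 0" using i0 f_0 x by (simp add: g_def)
    ultimately have "g i = 0" if "i \<le> Suc d" for i using that i0 by metis
    then have g0: "(1 - t) * u i = 0 \<and> t * f i x = 0" if "i \<le> Suc d" for i
      using that u0[OF that] f_nn[OF that x] t
      by (subst add_nonneg_eq_0_iff[symmetric]) (auto simp: g_def)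
    show False
    proof (cases "t < 1")
      case True
      then show False using g0 unz by auto
    next
      case False
      then have "\<forall>i\<le>Suc d. f i x = 0" using g0 t by auto
      then show False using empty[OF x] f_0 x by auto
    qed
  qed
  have "continuous_map (subtopology mtopology K) (nsphere d) (\<lambda>x. unit_vector d (V x))"
  proof (rule continuous_map_unit_vector)
    fix x assume "x \<in> topspace (subtopology mtopology K)"
    then obtain i0 where "x \<in> mspace m" "i0 \<le> Suc d" "x \<in> C i0" by (auto simp: K_def)
    then show "\<exists>i\<le>d. V x i \<noteq> 0" using nz[of x 1 "\<lambda>i. 0" "\<lambda>i. 0" i0] by auto
  qed (use V in \<open>auto intro: continuous_map_from_subtopology\<close>)
  with K have "\<exists>G. continuous_map mtopology (nsphere d) G \<and> (\<forall>x\<in>K. G x = unit_vector d (V x))"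
    by (intro dim[unfolded covering_dim_le_def, rule_format] conjI order_refl)
  then obtain G where G: "continuous_map mtopology (nsphere d) G" and GK: "\<And>x. x \<in> K \<Longrightarrow> G x = unit_vector d (V x)"
    by blast
  let ?\<Delta> = "subtopology (powertop_real UNIV) (standard_simplex (Suc d))"
  let ?b = "sphere_to_simplex d" and ?\<phi> = "barycenter (Suc d) p"
  let ?F = "\<lambda>y. ?\<phi> (?b y)"
  have \<phi>: "continuous_map ?\<Delta> mtopology ?\<phi>" by (rule continuous_map_barycenter[OF pX])
  have F: "continuous_map (nsphere d) mtopology ?F"
    using continuous_map_compose[OF continuous_map_sphere_to_simplex \<phi>] by (simp add: o_def)
  have FX: "?F y \<in> mspace m" if "y \<in> topspace (nsphere d)" for y
    using continuous_map_funspace[OF F] that by auto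
  have FC: "?F y \<in> C i" if y: "y \<in> topspace (nsphere d)" and i: "i \<le> Suc d" "?b y i = 0" for y i
  proof (rule barycenter_in_closed_convex[OF pX _ C[OF i(1)]])
    show "?b y \<in> standard_simplex (Suc d)" using sphere_to_simplex[OF y] by metis
    show "p j \<in> C i" if "j \<le> Suc d" "?b y j \<noteq> 0" for j using pC[of j i] that i by auto
  qed
  let ?T = "prod_topology (top_of_set {0..1::real}) (nsphere d)"
  \<comment> \<open>the normalized straight line from the identity to \<open>G\<close> on the boundary of the simplex\<close>
  let ?h = "\<lambda>z. unit_vector d (\<lambda>i. (1 - fst z) * snd z i + fst z * V (?F (snd z)) i)"
  have "continuous_map ?T (nsphere d) ?h"
  proof (rule continuous_map_unit_vector)
    fix i assume i: "i \<le> d"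
    have 1: "continuous_map ?T euclideanreal (\<lambda>z. fst z)"
      by (rule continuous_map_into_fulltopology[OF continuous_map_fst])
    have 2: "continuous_map ?T euclideanreal (\<lambda>z. snd z i)"
      using continuous_map_compose[OF continuous_map_snd continuous_map_nsphere_projection] by (simp add: o_def)
    have 3: "continuous_map ?T euclideanreal (\<lambda>z. V (?F (snd z)) i)"
      using continuous_map_compose[OF continuous_map_snd continuous_map_compose[OF F V[of i]]] i by (simp add: o_def)
    show "continuous_map ?T euclideanreal (\<lambda>z. (1 - fst z) * snd z i + fst z * V (?F (snd z)) i)"
      by (intro continuous_intros 1 2 3) 
  next
    fix z assume "z \<in> topspace ?T"
    then have t: "0 \<le> fst z" "fst z \<le> 1" and y: "snd z \<in> topspace (nsphere d)" by auto
    obtain s where s: "s > 0" and b0: "\<And>i. i \<le> Suc d \<Longrightarrow> ?b (snd z) i \<ge> 0"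
      and yb: "\<And>i. i \<le> d \<Longrightarrow> snd z i = s * (?b (snd z) i - ?b (snd z) (Suc d))"
      and simp: "?b (snd z) \<in> standard_simplex (Suc d)" and ex: "\<exists>i\<le>Suc d. ?b (snd z) i = 0"
      using sphere_to_simplex[OF y] by metis
    obtain i0 where i0: "i0 \<le> Suc d" "?b (snd z) i0 = 0" using ex by blast
    have "\<exists>i\<le>Suc d. ?b (snd z) i \<noteq> 0"
    proof (rule ccontr)
      assume "\<not> ?thesis"
      then have "(\<Sum>i\<le>Suc d. ?b (snd z) i) = 0" by (intro sum.neutral) auto
      then show False using simp by (simp add: standard_simplex_def)
    qed
    then show "\<exists>i\<le>d. (1 - fst z) * snd z i + fst z * V (?F (snd z)) i \<noteq> 0"
      using nz[of "?F (snd z)" "fst z" "\<lambda>i. s * ?b (snd z) i" "snd z" i0] t y s b0 yb i0 FX FC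
      by (auto simp: algebra_simps)
  qed
  moreover have "?h (0, y) = id y" if "y \<in> topspace (nsphere d)" for y
    using unit_vector_nsphere[OF that] by simp
  moreover have "?h (1, y) = ((G \<circ> ?\<phi>) \<circ> ?b) y" if y: "y \<in> topspace (nsphere d)" for y
  proof -
    obtain i where "i \<le> Suc d" "?b y i = 0" using sphere_to_simplex[OF y] by metis
    then have "?F y \<in> K" using FC[OF y] unfolding K_def by blast
    then show ?thesis using GK by simp
  qed
  ultimately have "homotopic_with (\<lambda>_. True) (nsphere d) (nsphere d) id ((G \<circ> ?\<phi>) \<circ> ?b)"
    by (subst homotopic_with) (auto intro!: exI[of _ ?h])
  moreover obtain c where "homotopic_with (\<lambda>_. True) (nsphere d) (nsphere d) ((G \<circ> ?\<phi>) \<circ> ?b) (\<lambda>_. c)"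
    using nullhomotopic_through_contractible_space[OF continuous_map_sphere_to_simplex
        continuous_map_compose[OF \<phi> G] contractible_space_standard_simplex] .
  ultimately have "contractible_space (nsphere d)"
    unfolding contractible_space_def using homotopic_with_trans by blast
  then show False using non_contractible_space_nsphere by blast
qed

end

section \<open>Fixed points of isometric actions\<close>

locale CAT0_action = complete_CAT0 m + group \<Gamma>
  for m :: "'x metric" and \<Gamma> :: "('g, 'b) monoid_scheme" (structure) +
  fixes \<phi> :: "'g \<Rightarrow> 'x \<Rightarrow> 'x"
  assumes action: "\<phi> \<in> hom \<Gamma> (isometry_group m)"
begin

lemma action_Bij: "g \<in> carrier \<Gamma> \<Longrightarrow> \<phi> g \<in> Bij (mspace m)"
  using action by (auto simp: hom_def isometry_group_def)

lemma action_closed: "g \<in> carrier \<Gamma> \<Longrightarrow> x \<in> mspace m \<Longrightarrow> \<phi> g x \<in> mspace m"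
  using Bij_imp_funcset[OF action_Bij] by blast

lemma action_isometry:
  "\<lbrakk>g \<in> carrier \<Gamma>; x \<in> mspace m; y \<in> mspace m\<rbrakk> \<Longrightarrow> mdist m (\<phi> g x) (\<phi> g y) = mdist m x y"
  using action by (auto simp: hom_def isometry_group_def)

lemma action_mult:
  assumes "g \<in> carrier \<Gamma>" "h \<in> carrier \<Gamma>" "x \<in> mspace m"
  shows "\<phi> (g \<otimes> h) x = \<phi> g (\<phi> h x)"
proof -
  have "\<phi> (g \<otimes> h) = compose (mspace m) (\<phi> g) (\<phi> h)"
    using action assms action_Bij by (simp add: hom_def isometry_group_def BijGroup_def)
  then show ?thesis using assms by (simp add: compose_eq)
qed

lemma action_one: "x \<in> mspace m \<Longrightarrow> \<phi> \<one> x = x"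
proof -
  assume x: "x \<in> mspace m"
  have "\<phi> \<one> (\<phi> \<one> x) = \<phi> \<one> x" using action_mult[of \<one> \<one> x] x by simp
  moreover have "inj_on (\<phi> \<one>) (mspace m)" using action_Bij[of \<one>] by (simp add: Bij_def bij_betw_def)
  ultimately show ?thesis using x action_closed[of \<one> x] by (simp add: inj_on_eq_iff)
qed

definition fixset :: "'g set \<Rightarrow> 'x set" where
  "fixset S = {x \<in> mspace m. \<forall>g\<in>S. \<phi> g x = x}"

lemma stabilizer_subgroup:
  assumes x: "x \<in> mspace m"
  shows "subgroup {g \<in> carrier \<Gamma>. \<phi> g x = x} \<Gamma>"
proof (rule subgroupI)
  show "{g \<in> carrier \<Gamma>. \<phi> g x = x} \<noteq> {}" using action_one[OF x] by auto
  show "inv g \<in> {g \<in> carrier \<Gamma>. \<phi> g x = x}" if "g \<in> {g \<in> carrier \<Gamma>. \<phi> g x = x}" for g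
    using that action_mult[of "inv g" g x] action_one[OF x] x by auto
qed (use action_mult x in auto)

text \<open>If \<open>w\<close> divides a segment with fixed end points, then so does its image, in the same ratio; hence the
  two agree by the uniqueness of geodesics.\<close>

lemma closed_convex_fixset:
  assumes S: "S \<subseteq> carrier \<Gamma>"
  shows "closed_convex (fixset S)"
  unfolding closed_convex_def geodesically_convex_def
proof (intro conjI ballI impI)
  show "fixset S \<subseteq> mspace m" by (auto simp: fixset_def)
  show "closedin mtopology (fixset S)"
    unfolding closedin_metric
  proof (intro conjI allI impI)
    show "fixset S \<subseteq> mspace m" by (auto simp: fixset_def)
    fix x assume "x \<in> mspace m - fixset S"
    then obtain g where g: "g \<in> S" "\<phi> g x \<noteq> x" and x: "x \<in> mspace m" by (auto simp: fixset_def)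
    have gG: "g \<in> carrier \<Gamma>" using g S by auto
    have gx: "\<phi> g x \<in> mspace m" using action_closed gG x by blast
    let ?r = "mdist m (\<phi> g x) x / 2"
    have "\<phi> g y \<noteq> y" if y: "y \<in> mball x ?r" for y
    proof
      assume "\<phi> g y = y"
      moreover have yX: "y \<in> mspace m" and "mdist m x y < ?r" using y by auto
      moreover have "mdist m (\<phi> g x) x \<le> mdist m (\<phi> g x) (\<phi> g y) + mdist m y x"
        using triangle[OF gx yX x] \<open>\<phi> g y = y\<close> by simp
      ultimately show False using action_isometry[OF gG x yX] by (simp add: commute)
    qed
    then have "disjnt (fixset S) (mball x ?r)" using g by (auto simp: disjnt_def fixset_def)
    moreover have "?r > 0" using g gx x by simp
    ultimately show "\<exists>r>0. disjnt (fixset S) (mball x r)" by blast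
  qed
  fix y z w assume y: "y \<in> fixset S" and z: "z \<in> fixset S" and w: "w \<in> mspace m"
    and btw: "mdist m y w + mdist m w z = mdist m y z"
  have yX: "y \<in> mspace m" and zX: "z \<in> mspace m" using y z by (auto simp: fixset_def)
  have "\<phi> g w = w" if g: "g \<in> S" for g
  proof -
    have gG: "g \<in> carrier \<Gamma>" using g S by auto
    have gwX: "\<phi> g w \<in> mspace m" using action_closed gG w by blast
    have gyw: "mdist m (\<phi> g w) y = mdist m y w" and gzw: "mdist m (\<phi> g w) z = mdist m w z"
      using action_isometry[OF gG w yX] action_isometry[OF gG w zX] y z g by (auto simp: fixset_def commute)
    show ?thesis
    proof (cases "mdist m y z = 0")
      case True
      then have "mdist m y w = 0" using btw nonneg[of y w] nonneg[of w z] by linarith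
      then have "w = y" using yX w by simp
      then show ?thesis using y g by (auto simp: fixset_def)
    next
      case False
      define D where "D = mdist m y z"
      define s where "s = mdist m y w / D"
      have D: "D > 0" using False nonneg[of y z] unfolding D_def by linarith
      have ys: "mdist m y w = s * D" using D by (simp add: s_def)
      have zs: "mdist m w z = (1 - s) * D" using btw ys by (simp add: D_def algebra_simps)
      have s: "0 \<le> s" "s \<le> 1"
        using D btw nonneg[of y w] nonneg[of w z] unfolding s_def divide_le_eq_1 D_def[symmetric]
        by (simp, linarith)
      have "(mdist m (\<phi> g w) w)\<^sup>2 \<le> (1 - s) * (s * D)\<^sup>2 + s * ((1 - s) * D)\<^sup>2 - s * (1 - s) * D\<^sup>2"
        using division_point_inequality[OF gwX yX zX w s] ys zs gyw gzw by (simp add: D_def)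
      also have "\<dots> = 0" by (simp add: power2_eq_square algebra_simps)
      finally show ?thesis using gwX w by simp
    qed
  qed
  then show "w \<in> fixset S" using w by (auto simp: fixset_def)
qed

text \<open>The point that minimizes the sum of squared distances to an orbit is fixed, because the group only
  permutes the summands. A finite set that is closed under multiplication is a subgroup.\<close>

lemma finite_subgroup_has_fixed_point:
  assumes S: "S \<subseteq> carrier \<Gamma>" "finite S" "S \<noteq> {}" and mult: "\<And>g h. g \<in> S \<Longrightarrow> h \<in> S \<Longrightarrow> g \<otimes> h \<in> S"
  shows "fixset S \<noteq> {}"
proof -
  obtain x where x: "x \<in> mspace m" using nonempty by blast
  let ?w = "\<lambda>_::'g. 1 / real (card S)" and ?p = "\<lambda>g. \<phi> g x"
  have pX: "?p g \<in> mspace m" if "g \<in> S" for g using action_closed S x that by blast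
  obtain b where b: "b \<in> mspace m"
    and var: "\<And>y. y \<in> mspace m \<Longrightarrow> energy S ?w ?p b + (mdist m b y)\<^sup>2 \<le> energy S ?w ?p y"
    using energy_minimizer_exists[of S ?w ?p "mspace m", OF S(2) _ _ pX closed_convex_mspace nonempty] S
    by auto
  have "\<phi> h b = b" if h: "h \<in> S" for h
  proof -
    have hG: "h \<in> carrier \<Gamma>" using h S by auto
    have inj: "inj_on (\<lambda>g. h \<otimes> g) S" by (rule inj_onI) (use S hG in \<open>metis Units_l_cancel Units_eq subsetD\<close>)
    have "(\<lambda>g. h \<otimes> g) ` S = S"
      using inj S(2) h mult by (intro card_subset_eq) (auto simp: card_image)
    then have "energy S ?w ?p (\<phi> h b) = (\<Sum>g\<in>(\<lambda>g. h \<otimes> g) ` S. ?w g * (mdist m (\<phi> h b) (?p g))\<^sup>2)"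
      by (simp add: energy_def)
    also have "\<dots> = (\<Sum>g\<in>S. ?w g * (mdist m (\<phi> h b) (?p (h \<otimes> g)))\<^sup>2)"
      by (simp add: sum.reindex[OF inj])
    also have "\<dots> = energy S ?w ?p b"
      unfolding energy_def
    proof (rule sum.cong)
      fix g assume g: "g \<in> S"
      then have "?p (h \<otimes> g) = \<phi> h (?p g)" using action_mult[OF hG] S x by blast
      then show "?w g * (mdist m (\<phi> h b) (?p (h \<otimes> g)))\<^sup>2 = ?w g * (mdist m b (?p g))\<^sup>2"
        using action_isometry[OF hG b pX[OF g]] by simp
    qed simp
    finally have "(mdist m b (\<phi> h b))\<^sup>2 \<le> 0" using var[OF action_closed[OF hG b]] by simp
    then show ?thesis using b action_closed[OF hG b] by simp
  qed
  then have "b \<in> fixset S" using b by (simp add: fixset_def)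
  then show ?thesis by blast
qed

text \<open>The hypothesis \<open>norm\<close> says that \<open>h\<close> preserves the fixed point set of \<open>S\<close>; it holds for
  instance if \<open>h\<close> normalizes the group generated by \<open>S\<close>. The projection to this set then commutes with
  \<open>h\<close> on the fixed points of \<open>h\<close>.\<close>

lemma fixset_insert_normalizing:
  assumes S: "S \<subseteq> carrier \<Gamma>" and h: "h \<in> carrier \<Gamma>"
    and fS: "fixset S \<noteq> {}" and fh: "fixset {h} \<noteq> {}"
    and norm: "\<And>s x. s \<in> S \<Longrightarrow> x \<in> fixset S \<Longrightarrow> \<phi> (s \<otimes> h) x = \<phi> h x"
  shows "fixset (insert h S) \<noteq> {}"
proof -
  obtain p where p: "p \<in> mspace m" "\<phi> h p = p" using fh by (auto simp: fixset_def)
  obtain y where y: "y \<in> fixset S"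
    and proj: "\<And>c. c \<in> fixset S \<Longrightarrow> (mdist m p y)\<^sup>2 + (mdist m y c)\<^sup>2 \<le> (mdist m p c)\<^sup>2"
    using projection_exists[OF closed_convex_fixset[OF S] fS p(1)] by blast
  have yX: "y \<in> mspace m" using y by (simp add: fixset_def)
  have "\<phi> s (\<phi> h y) = \<phi> h y" if "s \<in> S" for s
    using norm[OF that y] action_mult[OF _ h yX] S that by auto
  then have "\<phi> h y \<in> fixset S" using action_closed[OF h yX] by (simp add: fixset_def)
  moreover have "mdist m p (\<phi> h y) = mdist m p y" using action_isometry[OF h p(1) yX] p by simp
  ultimately have "(mdist m y (\<phi> h y))\<^sup>2 \<le> 0" using proj[of "\<phi> h y"] by simp
  then have "\<phi> h y = y" using yX action_closed[OF h yX] by simp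
  then have "y \<in> fixset (insert h S)" using y by (simp add: fixset_def)
  then show ?thesis by blast
qed

lemma Helly_fixset:
  assumes dim: "covering_dim_le mtopology d"
    and A: "\<And>i. i \<le> Suc d \<Longrightarrow> A i \<subseteq> carrier \<Gamma>"
    and meet: "\<And>k. k \<le> Suc d \<Longrightarrow> fixset (\<Union>i\<in>{..Suc d} - {k}. A i) \<noteq> {}"
  shows "fixset (\<Union>i\<le>Suc d. A i) \<noteq> {}"
proof -
  have "\<exists>x\<in>mspace m. \<forall>i\<le>Suc d. x \<in> fixset (A i)"
  proof (rule Helly[OF dim])
    show "closed_convex (fixset (A i))" if "i \<le> Suc d" for i
      using closed_convex_fixset A that by blast
    fix k assume "k \<le> Suc d"
    then obtain x where "x \<in> fixset (\<Union>i\<in>{..Suc d} - {k}. A i)" using meet by blast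
    then show "\<exists>x\<in>mspace m. \<forall>i\<le>Suc d. i \<noteq> k \<longrightarrow> x \<in> fixset (A i)"
      by (intro bexI[of _ x]) (auto simp: fixset_def)
  qed
  then show ?thesis by (auto simp: fixset_def)
qed

end

(* The determinant and the transposition of indices are those of the library of matrices of variable
   size and of the library of permutations. *)
hide_const (open) Determinants.det Finite_Cartesian_Product.transpose

section \<open>Elementary matrices in GL(n,Z) and SL(n,Z)\<close>

lemma group_GL_int: "group (GL_int n)"
  unfolding GL_int_def by (intro monoid.units_group ring.is_monoid ring_mat)

lemma mult_GL_int [simp]: "mult (GL_int n) = (*)" and one_GL_int [simp]: "one (GL_int n) = 1\<^sub>m n"
  by (simp_all add: GL_int_def units_of_def ring_mat_simps)

lemma carrier_GL_int_iff:
  "A \<in> carrier (GL_int n) \<longleftrightarrow> A \<in> carrier_mat n n \<and> (\<exists>B\<in>carrier_mat n n. B * A = 1\<^sub>m n \<and> A * B = 1\<^sub>m n)"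
  by (auto simp: GL_int_def units_of_def ring_mat_simps Units_def)

lemma GL_int_carrier_mat: "A \<in> carrier (GL_int n) \<Longrightarrow> A \<in> carrier_mat n n"
  by (simp add: carrier_GL_int_iff)

lemma det_GL_int:
  assumes "A \<in> carrier (GL_int n)"
  shows "det A = 1 \<or> det A = -1"
proof -
  obtain B where A: "A \<in> carrier_mat n n" and B: "B \<in> carrier_mat n n" "B * A = 1\<^sub>m n"
    using assms by (auto simp: carrier_GL_int_iff)
  have "det B * det A = 1" using det_mult[OF B(1) A] B(2) by simp
  then show ?thesis by (metis mult.commute zmult_eq_1_iff)
qed

lemma mult_SL_int [simp]: "mult (SL_int n) = (*)" and one_SL_int [simp]: "one (SL_int n) = 1\<^sub>m n"
  by (simp_all add: SL_int_def)

lemma carrier_SL_int: "carrier (SL_int n) = {A \<in> carrier (GL_int n). det A = 1}"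
  by (simp add: SL_int_def)

lemma SL_int_subgroup: "subgroup {A \<in> carrier (GL_int n). det A = 1} (GL_int n)"
proof -
  interpret group "GL_int n" by (rule group_GL_int)
  show ?thesis
  proof (rule subgroupI)
    show "{A \<in> carrier (GL_int n). det A = 1} \<noteq> {}" using one_closed by auto
    fix A assume A: "A \<in> {A \<in> carrier (GL_int n). det A = 1}"
    have "det (inv\<^bsub>GL_int n\<^esub> A) * det A = 1"
      using det_mult[of "inv\<^bsub>GL_int n\<^esub> A" n A] l_inv[of A] A GL_int_carrier_mat inv_closed by simp
    then show "inv\<^bsub>GL_int n\<^esub> A \<in> {A \<in> carrier (GL_int n). det A = 1}" using A by simp
    fix B assume B: "B \<in> {A \<in> carrier (GL_int n). det A = 1}"
    show "A \<otimes>\<^bsub>GL_int n\<^esub> B \<in> {A \<in> carrier (GL_int n). det A = 1}"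
      using A B m_closed[of A B] det_mult[of A n B] GL_int_carrier_mat by simp
  qed auto
qed

lemma group_SL_int: "group (SL_int n)"
  unfolding SL_int_def by (intro subgroup.subgroup_is_group SL_int_subgroup group_GL_int)

abbreviation elementary :: "nat \<Rightarrow> nat \<Rightarrow> nat \<Rightarrow> int mat" where
  "elementary n i j \<equiv> addrow_mat n 1 i j"

lemma addrow_mat_SL_int:
  assumes "i < n" "j < n" "i \<noteq> j"
  shows "addrow_mat n a i j \<in> carrier (SL_int n)"
proof -
  have "addrow_mat n (-a) i j * addrow_mat n a i j = 1\<^sub>m n" "addrow_mat n a i j * addrow_mat n (-a) i j = 1\<^sub>m n"
    using addrow_mat_inv[OF assms, of a] addrow_mat_inv[OF assms, of "-a"] by auto
  then show ?thesis using assms det_addrow_mat[of i j n a]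
    by (auto simp: carrier_SL_int carrier_GL_int_iff intro!: bexI[of _ "addrow_mat n (-a) i j"])
qed

lemma addrow_mat_add:
  fixes a b :: int
  assumes "i < n" "j < n" "i \<noteq> j"
  shows "addrow_mat n a i j * addrow_mat n b i j = addrow_mat n (a + b) i j"
  by (subst addrow_mat[symmetric, of _ _ n], use assms in auto)

lemma elementary_commute:
  assumes "i < n" "j < n" "k < n" "l < n" "i \<noteq> j" "k \<noteq> l" "l \<noteq> i" "k \<noteq> j"
  shows "elementary n k l * elementary n i j = elementary n i j * elementary n k l"
  by (subst (1 2) addrow_mat[symmetric, of _ _ n], use assms in auto)

lemma elementary_mult_right:
  assumes "k < n" "i < n" "j < n" "i \<noteq> j" "k \<noteq> i" "k \<noteq> j"
  shows "elementary n k i * elementary n i j = elementary n i j * (elementary n k i * elementary n k j)"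
  apply (subst addrow_mat[symmetric, of _ _ n], use assms in simp, use assms in simp)
  apply (subst addrow_mat[symmetric, of _ _ n], use assms in simp, use assms in simp)
  apply (subst addrow_mat[symmetric, of _ _ n], use assms in simp, use assms in simp)
  using assms by (intro eq_matI) auto

lemma elementary_mult_left:
  assumes "l < n" "i < n" "j < n" "i \<noteq> j" "l \<noteq> i" "l \<noteq> j"
  shows "elementary n j l * elementary n i j = elementary n i j * (elementary n j l * addrow_mat n (-1) i l)"
  apply (subst addrow_mat[symmetric, of _ _ n], use assms in simp, use assms in simp)
  apply (subst addrow_mat[symmetric, of _ _ n], use assms in simp, use assms in simp)
  apply (subst addrow_mat[symmetric, of _ _ n], use assms in simp, use assms in simp)
  using assms by (intro eq_matI) auto

lemma elementary_commutator:
  assumes "k < n" "i < n" "j < n" "i \<noteq> j" "k \<noteq> i" "k \<noteq> j"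
  shows "elementary n k j = addrow_mat n (-1) k i * (addrow_mat n (-1) i j * (elementary n k i * elementary n i j))"
  apply (subst addrow_mat[symmetric, of _ _ n], use assms in simp, use assms in simp)
  apply (subst addrow_mat[symmetric, of _ _ n], use assms in simp, use assms in simp)
  apply (subst addrow_mat[symmetric, of _ _ n], use assms in simp, use assms in simp)
  using assms by (intro eq_matI) auto

lemma swaprows_mat_conj_elementary:
  assumes "a < n" "b < n" "k < n" "l < n" "k \<noteq> l"
  shows "swaprows_mat n a b * elementary n k l * swaprows_mat n a b
    = elementary n (transpose a b k) (transpose a b l)"
proof -
  let ?P = "swaprows_mat n a b :: int mat"
  have t: "transpose a b k < n" "transpose a b l < n" using assms by (simp_all add: Transposition.transpose_def)
  have P_entry: "?P $$ (i,j) = (if transpose a b i = j then 1 else 0)" if "i < n" "j < n" for i j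
    using that by (auto simp: Transposition.transpose_def)
  have swap_entry: "swaprows a b A $$ (i,j) = A $$ (transpose a b i, j)"
    if "A \<in> carrier_mat n n" "i < n" "j < n" for A :: "int mat" and i j
    using that by (auto simp: Transposition.transpose_def)
  have tn: "transpose a b i < n" if "i < n" for i
    using that assms by (simp add: Transposition.transpose_def)
  have "swaprows a b (elementary n k l) = addrow 1 (transpose a b k) (transpose a b l) ?P"
  proof (rule eq_matI)
    fix i j assume "i < dim_row (addrow 1 (transpose a b k) (transpose a b l) ?P)"
      and "j < dim_col (addrow 1 (transpose a b k) (transpose a b l) ?P)"
    then have ij: "i < n" "j < n" by simp_all
    have k: "k = transpose a b i \<longleftrightarrow> transpose a b k = i" by (metis transpose_involutory)
    show "swaprows a b (elementary n k l) $$ (i,j) = addrow 1 (transpose a b k) (transpose a b l) ?P $$ (i,j)"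
      unfolding swap_entry[OF addrow_mat_carrier ij]
      by (simp only: index_mat_addrow_mat(1)[OF tn[OF ij(1)] ij(2)] index_mat_addrow(1) index_mat_swaprows_mat(2,3)
          ij P_entry[OF tn[OF assms(4)] ij(2)] P_entry[OF ij] k) (simp add: transpose_involutory)
  qed simp_all
  then have "?P * elementary n k l = elementary n (transpose a b k) (transpose a b l) * ?P"
    using addrow_mat[OF swaprows_mat_carrier t(2)] swaprows_mat[OF addrow_mat_carrier assms(1,2)] by metis
  then have "?P * elementary n k l * ?P = elementary n (transpose a b k) (transpose a b l) * (?P * ?P)"
    by (simp add: assoc_mult_mat[of _ n n _ n _ n])
  also have "?P * ?P = 1\<^sub>m n" by (rule swaprows_mat_inv) (use assms in auto)
  finally show ?thesis by simp
qed

lemma SL_int_inclusion_hom: "(\<lambda>A. A) \<in> hom (SL_int n) (GL_int n)"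
  by (auto simp: hom_def carrier_SL_int)

section \<open>Integer row reduction of matrices of determinant 1\<close>

text \<open>A left inverse is carried along with the determinant because it gives at once that the entries of a
  column that is being cleared are coprime.\<close>

definition unimodular :: "nat \<Rightarrow> int mat \<Rightarrow> bool" where
  "unimodular n A \<longleftrightarrow> A \<in> carrier_mat n n \<and> det A = 1 \<and> (\<exists>B\<in>carrier_mat n n. B * A = 1\<^sub>m n)"

lemma unimodular_addrow:
  assumes A: "unimodular n A" and ij: "i < n" "j < n" "i \<noteq> j"
  shows "unimodular n (addrow a i j A)"
proof -
  obtain B where B: "B \<in> carrier_mat n n" "B * A = 1\<^sub>m n" and Ac: "A \<in> carrier_mat n n" and d: "det A = 1"
    using A by (auto simp: unimodular_def)
  let ?E = "addrow_mat n a i j" and ?F = "addrow_mat n (-a) i j"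
  have eq: "addrow a i j A = ?E * A" by (rule addrow_mat[OF Ac ij(2)])
  have FE: "?F * ?E = 1\<^sub>m n" using addrow_mat_inv[OF ij, of "-a"] by simp
  have "(B * ?F) * (?E * A) = B * (?F * (?E * A))"
    using B Ac by (intro assoc_mult_mat[of _ n n _ n _ n]) auto
  also have "?F * (?E * A) = (?F * ?E) * A"
    using Ac by (intro assoc_mult_mat[symmetric, of _ n n _ n _ n]) auto
  also have "B * \<dots> = 1\<^sub>m n" using FE Ac B by simp
  finally have "(B * ?F) * (?E * A) = 1\<^sub>m n" .
  moreover have "det (?E * A) = 1"
    using det_mult[of ?E n A] det_addrow_mat[of i j n a] ij Ac d by simp
  ultimately show ?thesis unfolding unimodular_def eq
    using B Ac by (intro conjI bexI[of _ "B * ?F"]) auto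
qed

definition cols_cleared :: "nat \<Rightarrow> nat \<Rightarrow> int mat \<Rightarrow> bool" where
  "cols_cleared n k A \<longleftrightarrow> (\<forall>j<k. \<forall>i<n. A $$ (i,j) = (if i = j then 1 else 0))"

lemma cols_cleared_addrow:
  assumes "cols_cleared n k A" "A \<in> carrier_mat n n" "k \<le> j" "j < n" "k \<le> n"
  shows "cols_cleared n k (addrow a i j A)"
  using assms by (auto simp: cols_cleared_def)

text \<open>An induction principle: a property of the identity matrix that can be pulled back along the
  addition of a multiple of one row to another holds for all integer matrices of determinant \<open>1\<close>. The
  columns are cleared from left to right. In column \<open>k\<close>, the Euclidean algorithm on the rows from \<open>k\<close> on
  reduces the sum of the absolute values until a single nonzero entry is left. It is \<open>1\<close> or \<open>-1\<close> by
  \<open>row\<close> below; if it can be moved through another row, it becomes a pivot \<open>1\<close>, and in the last column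
  its sign is that of the determinant.\<close>

lemma unimodular_row_reduction:
  assumes A: "unimodular n A" and one: "P (1\<^sub>m n)"
    and step: "\<And>A i j a. \<lbrakk>A \<in> carrier_mat n n; i < n; j < n; i \<noteq> j; P (addrow a i j A)\<rbrakk> \<Longrightarrow> P A"
  shows "P A"
proof -
  have main: "unimodular n A \<Longrightarrow> cols_cleared n k A \<Longrightarrow> P A" if "k \<le> n" for k A
    using that
  proof (induction arbitrary: A rule: inc_induct)
    case base
    then have "A = 1\<^sub>m n" by (intro eq_matI) (auto simp: cols_cleared_def unimodular_def)
    then show ?case using one by simp
  next
    case (step k)
    note IH = step.IH and kn = step.hyps(2)
    \<comment> \<open>Once the pivot is 1, it clears its column and the induction hypothesis for \<open>k + 1\<close> applies.\<close>
    have pivot: "P A" if "unimodular n A" "cols_cleared n k A" "A $$ (k,k) = 1" for A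
      using that
    proof (induction "card {i. i < n \<and> i \<noteq> k \<and> A $$ (i,k) \<noteq> 0}" arbitrary: A rule: less_induct)
      case less
      have Ac: "A \<in> carrier_mat n n" using less.prems by (simp add: unimodular_def)
      show ?case
      proof (cases "{i. i < n \<and> i \<noteq> k \<and> A $$ (i,k) \<noteq> 0} = {}")
        case True
        then have "cols_cleared n (Suc k) A"
          using less.prems by (auto simp: cols_cleared_def less_Suc_eq)
        then show ?thesis using IH less.prems by blast
      next
        case False
        then obtain i where i: "i < n" "i \<noteq> k" "A $$ (i,k) \<noteq> 0" by blast
        let ?A = "addrow (- A $$ (i,k)) i k A"
        have entry: "?A $$ (l,k) = (if l = i then 0 else A $$ (l,k))" if "l < n" for l
          using that i kn Ac less.prems(3) by simp
        have "{l. l < n \<and> l \<noteq> k \<and> ?A $$ (l,k) \<noteq> 0} \<subseteq> {l. l < n \<and> l \<noteq> k \<and> A $$ (l,k) \<noteq> 0}"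
        proof
          fix l assume "l \<in> {l. l < n \<and> l \<noteq> k \<and> ?A $$ (l,k) \<noteq> 0}"
          then have "l < n" "l \<noteq> k" "?A $$ (l,k) \<noteq> 0" by simp_all
          then show "l \<in> {l. l < n \<and> l \<noteq> k \<and> A $$ (l,k) \<noteq> 0}" using entry[of l] by (simp split: if_splits)
        qed
        moreover have "i \<in> {l. l < n \<and> l \<noteq> k \<and> A $$ (l,k) \<noteq> 0}" using i by simp
        moreover have "i \<notin> {l. l < n \<and> l \<noteq> k \<and> ?A $$ (l,k) \<noteq> 0}" using entry[of i] i by simp
        ultimately have "{l. l < n \<and> l \<noteq> k \<and> ?A $$ (l,k) \<noteq> 0} \<subset> {l. l < n \<and> l \<noteq> k \<and> A $$ (l,k) \<noteq> 0}"
          by blast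
        then have "card {i. i < n \<and> i \<noteq> k \<and> ?A $$ (i,k) \<noteq> 0} < card {i. i < n \<and> i \<noteq> k \<and> A $$ (i,k) \<noteq> 0}"
          by (intro psubset_card_mono) auto
        then have "P ?A"
          using i kn Ac less.prems
          by (intro less.hyps unimodular_addrow cols_cleared_addrow) auto
        then show ?thesis using step.prems assms(3)[OF Ac i(1) kn i(2)] by blast
      qed
    qed
    \<comment> \<open>Row \<open>k\<close> of \<open>B\<close> vanishes left of the diagonal because the columns of \<open>A\<close> before \<open>k\<close> are
      standard, so the entries of column \<open>k\<close> from row \<open>k\<close> on are coprime.\<close>
    have row: "\<exists>b. (\<Sum>i=k..<n. b i * A $$ (i,k)) = 1" if uA: "unimodular n A" and cA: "cols_cleared n k A" for A
    proof -
      obtain B where B: "B \<in> carrier_mat n n" "B * A = 1\<^sub>m n" and Ac: "A \<in> carrier_mat n n"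
        using uA by (auto simp: unimodular_def)
      have prod: "(B * A) $$ (k,j) = (\<Sum>i<n. B $$ (k,i) * A $$ (i,j))" if "j < n" for j
        using that kn B(1) Ac by (simp add: scalar_prod_def lessThan_atLeast0)
      have "B $$ (k,j) = 0" if j: "j < k" for j
      proof -
        have "(\<Sum>i<n. B $$ (k,i) * A $$ (i,j)) = (\<Sum>i<n. if i = j then B $$ (k,i) else 0)"
          using cA j by (intro sum.cong) (auto simp: cols_cleared_def)
        also have "\<dots> = B $$ (k,j)" using j kn by simp
        finally show ?thesis using prod[of j] B(2) j kn by simp
      qed
      then have "(\<Sum>i=k..<n. B $$ (k,i) * A $$ (i,k)) = (\<Sum>i<n. B $$ (k,i) * A $$ (i,k))"
        by (intro sum.mono_neutral_left) auto
      also have "\<dots> = 1" using prod[OF kn] B(2) kn by simp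
      finally show ?thesis by (rule exI[of _ "\<lambda>i. B $$ (k,i)"])
    qed
    show ?case
      using step.prems
    proof (induction "\<Sum>i=k..<n. nat \<bar>A $$ (i,k)\<bar>" arbitrary: A rule: less_induct)
      case less
      have Ac: "A \<in> carrier_mat n n" using less.prems by (simp add: unimodular_def)
      show ?case
      proof (cases "\<exists>i\<in>{k..<n}. \<exists>j\<in>{k..<n}. i \<noteq> j \<and> A $$ (i,k) \<noteq> 0 \<and> A $$ (j,k) \<noteq> 0")
        case True
        then obtain i j where ij: "i \<in> {k..<n}" "j \<in> {k..<n}" "i \<noteq> j" "A $$ (j,k) \<noteq> 0"
          "\<bar>A $$ (j,k)\<bar> \<le> \<bar>A $$ (i,k)\<bar>"
          by (metis linear)
        define c where "c = (if (A $$ (i,k) > 0) = (A $$ (j,k) > 0) then -1 else (1::int))"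
        let ?A = "addrow c i j A"
        have lt: "nat \<bar>?A $$ (i,k)\<bar> < nat \<bar>A $$ (i,k)\<bar>"
          using ij Ac kn by (auto simp: c_def)
        have "(\<Sum>l=k..<n. nat \<bar>?A $$ (l,k)\<bar>) < (\<Sum>l=k..<n. nat \<bar>A $$ (l,k)\<bar>)"
        proof (rule sum_strict_mono_ex1)
          show "\<forall>l\<in>{k..<n}. nat \<bar>?A $$ (l,k)\<bar> \<le> nat \<bar>A $$ (l,k)\<bar>"
          proof
            fix l assume l: "l \<in> {k..<n}"
            show "nat \<bar>?A $$ (l,k)\<bar> \<le> nat \<bar>A $$ (l,k)\<bar>"
              using lt l Ac kn by (cases "l = i") auto
          qed
          show "\<exists>l\<in>{k..<n}. nat \<bar>?A $$ (l,k)\<bar> < nat \<bar>A $$ (l,k)\<bar>" using lt ij by blast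
        qed simp
        then have "P ?A"
          using ij Ac less.prems kn by (intro less.hyps unimodular_addrow cols_cleared_addrow) auto
        then show ?thesis using assms(3)[OF Ac, of i j c] ij by auto
      next
        case False
        obtain b where b: "(\<Sum>i=k..<n. b i * A $$ (i,k)) = 1" using row less.prems by blast
        then obtain i where i: "i \<in> {k..<n}" "A $$ (i,k) \<noteq> 0"
          by (metis (no_types, lifting) mult_zero_right sum.neutral zero_neq_one)
        have zero: "A $$ (j,k) = 0" if "j \<in> {k..<n}" "j \<noteq> i" for j using False i that by blast
        have "(\<Sum>l=k..<n. b l * A $$ (l,k)) = (\<Sum>l\<in>{i}. b l * A $$ (l,k))"
          using i zero by (intro sum.mono_neutral_right) auto
        then have "b i * A $$ (i,k) = 1" using b by simp
        then have v: "A $$ (i,k) = 1 \<or> A $$ (i,k) = -1" by (metis mult.commute zmult_eq_1_iff)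
        show ?thesis
        proof (cases "i = k")
          case False
          let ?A = "addrow (A $$ (i,k)) k i A"
          have "?A $$ (k,k) = 1" using i zero[of k] False v Ac kn by auto
          then have "P ?A" using False i kn Ac less.prems
            by (intro pivot unimodular_addrow cols_cleared_addrow) auto
          then show ?thesis using assms(3)[OF Ac, of k i] False i kn by auto
        next
          case [simp]: True
          show ?thesis
          proof (cases "A $$ (k,k) = 1")
            case True
            then show ?thesis using pivot less.prems by blast
          next
            case False
            then have neg: "A $$ (k,k) = -1" using v by simp
            have "Suc k < n"
            proof (rule ccontr)
              assume "\<not> Suc k < n"
              then have n: "n = Suc k" using kn by simp
              have ut: "upper_triangular A"
                using less.prems(2) Ac by (auto simp: upper_triangular_def cols_cleared_def n)
              have "det A = prod_list (diag_mat A)" by (rule det_upper_triangular[OF ut Ac])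
              also have "\<dots> = (\<Prod>i<n. A $$ (i,i))"
                using Ac by (simp add: prod_list_diag_prod lessThan_atLeast0)
              also have "\<dots> = A $$ (k,k) * (\<Prod>i<k. A $$ (i,i))" by (simp add: n)
              also have "(\<Prod>i<k. A $$ (i,i)) = 1"
                using less.prems(2) by (intro prod.neutral) (auto simp: cols_cleared_def n)
              finally show False using neg less.prems(1) by (simp add: unimodular_def)
            qed
            \<comment> \<open>Copy the pivot, negated, to the next row and add it back twice: \<open>-1 + 2 = 1\<close>.\<close>
            let ?A = "addrow (-1) (Suc k) k A"
            let ?B = "addrow 2 k (Suc k) ?A"
            have "?B $$ (k,k) = 1" using neg zero[of "Suc k"] Ac kn \<open>Suc k < n\<close> by auto
            then have "P ?B" using \<open>Suc k < n\<close> kn Ac less.prems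
              by (intro pivot unimodular_addrow cols_cleared_addrow) auto
            then have "P ?A" using assms(3)[of ?A k "Suc k" 2] Ac kn \<open>Suc k < n\<close> by auto
            then show ?thesis using assms(3)[OF Ac, of "Suc k" k "-1"] kn \<open>Suc k < n\<close> by auto
          qed
        qed
      qed
    qed
  qed
  show ?thesis using main[of 0 A] A by (simp add: cols_cleared_def)
qed

text \<open>Commutators of the elementary matrices along the path \<open>0, 1, \<dots>, n - 1\<close> give all those above the
  diagonal; the one that closes the cycle then gives the first column below the diagonal, and with it
  everything.\<close>

lemma SL_int_subgroup_eq:
  assumes H: "subgroup H (SL_int n)" and n: "2 \<le> n"
    and path: "\<And>i. Suc i < n \<Longrightarrow> elementary n i (Suc i) \<in> H" and last: "elementary n (n - 1) 0 \<in> H"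
  shows "carrier (SL_int n) \<subseteq> H"
proof -
  interpret group "SL_int n" by (rule group_SL_int)
  interpret H: subgroup H "SL_int n" by (rule H)
  have mult: "A * B \<in> H" if "A \<in> H" "B \<in> H" for A B using H.m_closed[OF that] by simp
  have neg: "addrow_mat n (-a) i j \<in> H" if "addrow_mat n a i j \<in> H" and ij: "i < n" "j < n" "i \<noteq> j" for a i j
  proof -
    have "addrow_mat n (-a) i j * addrow_mat n a i j = 1\<^sub>m n"
      using addrow_mat_inv[OF ij, of "-a"] by simp
    then have "inv\<^bsub>SL_int n\<^esub> (addrow_mat n a i j) = addrow_mat n (-a) i j"
      using addrow_mat_SL_int[OF ij] by (intro inv_equality) auto
    then show ?thesis using H.m_inv_closed[OF that(1)] by simp
  qed
  have comm: "elementary n k j \<in> H"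
    if "elementary n k i \<in> H" "elementary n i j \<in> H" "k < n" "i < n" "j < n" "i \<noteq> j" "k \<noteq> i" "k \<noteq> j" for k i j
    using elementary_commutator[of k n i j] that neg[of 1 k i] neg[of 1 i j] mult by simp
  have up: "elementary n i j \<in> H" if "i < j" "j < n" for i j
    using that
  proof (induction j rule: less_induct)
    case (less j)
    show ?case
    proof (cases "j = Suc i")
      case True
      then show ?thesis using path less.prems by simp
    next
      case False
      then obtain j' where j': "j = Suc j'" "i < j'" using less.prems by (cases j) auto
      then show ?thesis using comm[of i j' j] less.IH[of j'] path[of j'] less.prems by simp
    qed
  qed
  have col0: "elementary n i 0 \<in> H" if "0 < i" "i < n" for i
    using comm[of i "n - 1" 0] up[of i "n - 1"] last that by (cases "i = n - 1") auto
  have all: "elementary n i j \<in> H" if "i < n" "j < n" "i \<noteq> j" for i j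
    using comm[of i 0 j] col0[of i] up[of i j] up[of 0 j] that by (cases "i < j"; cases "j = 0") auto
  have nat_mult: "addrow_mat n (int a) i j \<in> H" if ij: "i < n" "j < n" "i \<noteq> j" for a i j
  proof (induction a)
    case 0
    have "addrow_mat n 0 i j = (1\<^sub>m n :: int mat)" by (intro eq_matI) auto
    then show ?case using H.one_closed by simp
  next
    case (Suc a)
    then show ?case using mult[OF all[OF ij] Suc] addrow_mat_add[OF ij, of 1 "int a"] by simp
  qed
  have addrowH: "addrow_mat n a i j \<in> H" if ij: "i < n" "j < n" "i \<noteq> j" for a i j
    using nat_mult[OF ij] neg[OF nat_mult[OF ij] ij] by (cases a rule: int_cases2) auto
  show ?thesis
  proof
    fix A assume A: "A \<in> carrier (SL_int n)"
    then have "unimodular n A" by (auto simp: carrier_SL_int carrier_GL_int_iff unimodular_def)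
    then show "A \<in> H"
    proof (rule unimodular_row_reduction)
      show "1\<^sub>m n \<in> H" using H.one_closed by simp
      fix A :: "int mat" and i j a
      assume A: "A \<in> carrier_mat n n" and ij: "i < n" "j < n" "i \<noteq> j" and "addrow a i j A \<in> H"
      then have "addrow_mat n (-a) i j * (addrow_mat n a i j * A) \<in> H"
        using mult addrowH addrow_mat[OF A ij(2)] by metis
      moreover have "addrow_mat n (-a) i j * (addrow_mat n a i j * A) = A"
        using assoc_mult_mat[OF addrow_mat_carrier addrow_mat_carrier A, symmetric, of "-a" i j a i j]
          addrow_mat_inv[OF ij, of "-a"] A by simp
      ultimately show "A \<in> H" by simp
    qed
  qed
qed

section \<open>An affine Coxeter group in GL(n,Z)\<close>

lemma finite_bounded_matrices:
  "finite {A \<in> carrier_mat n n. \<forall>i<n. \<forall>j<n. \<bar>A $$ (i,j)\<bar> \<le> (b::int)}"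
proof (rule finite_subset)
  show "{A \<in> carrier_mat n n. \<forall>i<n. \<forall>j<n. \<bar>A $$ (i,j)\<bar> \<le> b}
      \<subseteq> mat n n ` (PiE ({..<n} \<times> {..<n}) (\<lambda>_. {-b..b}))"
  proof
    fix A assume A: "A \<in> {A \<in> carrier_mat n n. \<forall>i<n. \<forall>j<n. \<bar>A $$ (i,j)\<bar> \<le> b}"
    let ?f = "restrict (\<lambda>ij. A $$ ij) ({..<n} \<times> {..<n})"
    have "A = mat n n ?f" using A by (intro eq_matI) auto
    moreover have "A $$ (i,j) \<in> {-b..b}" if "i < n" "j < n" for i j
    proof -
      have "\<bar>A $$ (i,j)\<bar> \<le> b" using A that by simp
      then show ?thesis by (simp add: abs_le_iff)
    qed
    then have "?f \<in> PiE ({..<n} \<times> {..<n}) (\<lambda>_. {-b..b})"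
      by (auto simp: restrict_PiE_iff)
    ultimately show "A \<in> mat n n ` (PiE ({..<n} \<times> {..<n}) (\<lambda>_. {-b..b}))" by blast
  qed
  show "finite (mat n n ` (PiE ({..<n} \<times> {..<n}) (\<lambda>_. {-b..b})))"
    by (intro finite_imageI finite_PiE) auto
qed

text \<open>A matrix that fixes the linear form \<open>x 0\<close> acts on the hyperplane \<open>x 0 = 1\<close> with affine coordinates
  \<open>x 1, \<dots>, x (n - 1)\<close>. These \<open>n\<close> matrices act as the reflections in the walls of an alcove of the affine Coxeter
  group of type \<open>C\<close>: the sign change of \<open>x 1\<close>, the exchanges of adjacent coordinates, and the reflection
  \<open>x (n - 1) \<mapsto> 1 - x (n - 1)\<close>.\<close>

definition reflection :: "nat \<Rightarrow> nat \<Rightarrow> int mat" where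
  "reflection n k = (if k = 0 then multrow_mat n 1 (-1)
     else if Suc k = n then elementary n k 0 * multrow_mat n k (-1)
     else swaprows_mat n k (Suc k))"

text \<open>All walls but the \<open>k\<close>-th pass through the vertex of the alcove whose coordinates are \<open>0\<close> up to
  index \<open>k\<close> and \<open>1/2\<close> beyond it. The form is, in column \<open>j\<close> of \<open>X\<close>, the square of \<open>x 0\<close> plus four times
  the squared distance to that vertex, homogenized; the factor four makes it integral.\<close>

definition vertex_form :: "nat \<Rightarrow> nat \<Rightarrow> int mat \<Rightarrow> nat \<Rightarrow> int" where
  "vertex_form n k X j = (X $$ (0,j))\<^sup>2 + (\<Sum>i=1..<n. (2 * X $$ (i,j) - (if k < i then X $$ (0,j) else 0))\<^sup>2)"

definition vertex_stabilizer :: "nat \<Rightarrow> nat \<Rightarrow> int mat set" where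
  "vertex_stabilizer n k = {A \<in> carrier (GL_int n).
     \<forall>X\<in>carrier_mat n n. \<forall>j<n. vertex_form n k (A * X) j = vertex_form n k X j}"

text \<open>The form is positive definite and integral, so applied to the identity matrix it bounds the entries
  of the matrices that preserve it.\<close>

lemma finite_vertex_stabilizer:
  "finite (vertex_stabilizer n k)"
proof -
  define b where "b = (\<Sum>j<n. vertex_form n k (1\<^sub>m n) j)"
  have form_nn: "vertex_form n k X j \<ge> 0" for X j
    unfolding vertex_form_def by (intro add_nonneg_nonneg sum_nonneg) auto
  have "\<bar>A $$ (i,j)\<bar> \<le> b" if A: "A \<in> vertex_stabilizer n k" and i: "i < n" and j: "j < n" for A i j
  proof -
    have Ac: "A \<in> carrier_mat n n" using A by (simp add: vertex_stabilizer_def GL_int_carrier_mat)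
    have "vertex_form n k A j = vertex_form n k (1\<^sub>m n) j"
      using A j Ac unfolding vertex_stabilizer_def by (auto dest!: bspec[of _ _ "1\<^sub>m n"])
    also have "\<dots> \<le> b" unfolding b_def using j form_nn by (intro member_le_sum) auto
    finally have le: "vertex_form n k A j \<le> b" .
    have sq: "\<bar>x\<bar> \<le> x\<^sup>2" for x :: int
    proof (cases "x = 0")
      case False
      then have "\<bar>x\<bar> * 1 \<le> \<bar>x\<bar> * \<bar>x\<bar>" by (intro mult_left_mono) auto
      then show ?thesis by (simp add: power2_eq_square flip: abs_mult)
    qed simp
    have S0: "0 \<le> (\<Sum>i=1..<n. (2 * A $$ (i,j) - (if k < i then A $$ (0,j) else 0))\<^sup>2)"
      by (intro sum_nonneg) auto
    show ?thesis
    proof (cases "i = 0")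
      case True
      then show ?thesis using le S0 sq[of "A $$ (0,j)"] unfolding vertex_form_def by simp
    next
      case False
      have "(2 * A $$ (i,j) - (if k < i then A $$ (0,j) else 0))\<^sup>2
          \<le> (\<Sum>i=1..<n. (2 * A $$ (i,j) - (if k < i then A $$ (0,j) else 0))\<^sup>2)"
        using False i by (intro member_le_sum[of i "{1..<n}" "\<lambda>i. (2 * A $$ (i,j) - (if k < i then A $$ (0,j) else 0))\<^sup>2"]) auto
      then have "\<bar>2 * A $$ (i,j) - (if k < i then A $$ (0,j) else 0)\<bar> + \<bar>A $$ (0,j)\<bar> \<le> b"
        using le sq[of "A $$ (0,j)"] sq[of "2 * A $$ (i,j) - (if k < i then A $$ (0,j) else 0)"]
        unfolding vertex_form_def by linarith
      then show ?thesis by (auto split: if_splits)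
    qed
  qed
  then have "vertex_stabilizer n k \<subseteq> {A \<in> carrier_mat n n. \<forall>i<n. \<forall>j<n. \<bar>A $$ (i,j)\<bar> \<le> b}"
    by (auto simp: vertex_stabilizer_def GL_int_carrier_mat)
  then show ?thesis by (rule finite_subset) (rule finite_bounded_matrices)
qed

lemma vertex_stabilizer_mult:
  assumes "A \<in> vertex_stabilizer n k" "B \<in> vertex_stabilizer n k"
  shows "A * B \<in> vertex_stabilizer n k"
proof -
  interpret group "GL_int n" by (rule group_GL_int)
  have AB: "A \<in> carrier (GL_int n)" "B \<in> carrier (GL_int n)" using assms by (auto simp: vertex_stabilizer_def)
  then have "A * B \<in> carrier (GL_int n)" using m_closed by fastforce
  moreover have "vertex_form n k (A * B * X) j = vertex_form n k X j" if X: "X \<in> carrier_mat n n" and j: "j < n" for X j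
  proof -
    have AB': "A \<in> carrier_mat n n" "B \<in> carrier_mat n n" using AB GL_int_carrier_mat by auto
    then have "A * B * X = A * (B * X)" using X by (intro assoc_mult_mat)
    moreover have "B * X \<in> carrier_mat n n" using AB' X by simp
    ultimately show ?thesis using assms X j by (simp add: vertex_stabilizer_def)
  qed
  ultimately show ?thesis by (simp add: vertex_stabilizer_def)
qed

lemma swaprows_mat_GL_int: "i < n \<Longrightarrow> j < n \<Longrightarrow> swaprows_mat n i j \<in> carrier (GL_int n)"
  by (auto simp: carrier_GL_int_iff swaprows_mat_inv intro!: bexI[of _ "swaprows_mat n i j"])

lemma multrow_mat_GL_int: "i < n \<Longrightarrow> multrow_mat n i (-1) \<in> carrier (GL_int n)"
proof -
  assume "i < n"
  then have "multrow_mat n i (-1) * multrow_mat n i (-1 :: int) = 1\<^sub>m n"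
    unfolding multrow_mat[OF multrow_mat_carrier, symmetric] by (intro eq_matI) auto
  then show "multrow_mat n i (-1) \<in> carrier (GL_int n)"
    unfolding carrier_GL_int_iff by (intro conjI bexI[of _ "multrow_mat n i (-1 :: int)"] multrow_mat_carrier)
qed

lemma elementary_GL_int: "\<lbrakk>i < n; j < n; i \<noteq> j\<rbrakk> \<Longrightarrow> addrow_mat n a i j \<in> carrier (GL_int n)"
  using addrow_mat_SL_int by (auto simp: carrier_SL_int)

lemma reflection_GL_int:
  assumes "2 \<le> n" "k < n"
  shows "reflection n k \<in> carrier (GL_int n)"
proof -
  interpret group "GL_int n" by (rule group_GL_int)
  show ?thesis using assms swaprows_mat_GL_int[of k n "Suc k"] multrow_mat_GL_int[of 1 n]
      m_closed[OF elementary_GL_int[of k n 0 1] multrow_mat_GL_int[of k n]]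
    by (auto simp: reflection_def)
qed

lemma reflection_in_vertex_stabilizer:
  assumes n: "2 \<le> n" and lk: "l < n" "k < n" "l \<noteq> k"
  shows "reflection n l \<in> vertex_stabilizer n k"
proof -
  have "vertex_form n k (reflection n l * X) j = vertex_form n k X j"
    if X: "X \<in> carrier_mat n n" and j: "j < n" for X j
  proof -
    consider "l = 0" | "l \<noteq> 0" "Suc l = n" | "l \<noteq> 0" "Suc l < n" using lk by linarith
    then show ?thesis
    proof cases
      case 1
      then have "reflection n l * X = multrow 1 (-1) X"
        using multrow_mat[OF X] by (simp add: reflection_def)
      then show ?thesis unfolding vertex_form_def
        using n j X lk 1 by (intro arg_cong2[of _ _ _ _ "(+)"] sum.cong) auto
    next
      case 2
      then have "reflection n l * X = addrow 1 l 0 (multrow l (-1) X)"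
        using multrow_mat[OF X, of l "-1"] addrow_mat[OF mult_carrier_mat[OF multrow_mat_carrier X], of 0 1 l l "-1"] n
          assoc_mult_mat[OF addrow_mat_carrier multrow_mat_carrier X, of 1 l 0 l "-1"]
        by (simp add: reflection_def)
      then show ?thesis unfolding vertex_form_def
        using n j X lk 2 by (intro arg_cong2[of _ _ _ _ "(+)"] sum.cong) (auto simp: power2_commute algebra_simps)
    next
      case 3
      then have eq: "reflection n l * X = swaprows l (Suc l) X"
        using swaprows_mat[OF X] lk by (simp add: reflection_def)
      have sw0: "swaprows l (Suc l) X $$ (0,j) = X $$ (0,j)" using 3 j X n by simp
      have "(\<Sum>i=1..<n. (2 * swaprows l (Suc l) X $$ (i,j) - (if k < i then X $$ (0,j) else 0))\<^sup>2)
        = (\<Sum>i=1..<n. (2 * X $$ (i,j) - (if k < i then X $$ (0,j) else 0))\<^sup>2)"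
        by (rule sum.reindex_bij_witness[of _ "transpose l (Suc l)" "transpose l (Suc l)"])
           (use 3 j X lk in \<open>auto simp: Transposition.transpose_def\<close>)
      then show ?thesis unfolding vertex_form_def eq sw0 by simp
    qed
  qed
  then show ?thesis using reflection_GL_int[OF n lk(1)] by (simp add: vertex_stabilizer_def)
qed

section \<open>Elliptic elementary matrices\<close>

text \<open>Quantifying over all actions makes these notions invariant under automorphisms of the group. This is
  used for the automorphisms of SL(n,Z) that are given by conjugation with permutation matrices of
  determinant \<open>-1\<close>.\<close>

definition always_elliptic :: "'x metric \<Rightarrow> ('g, 'b) monoid_scheme \<Rightarrow> 'g \<Rightarrow> bool" where
  "always_elliptic m \<Gamma> g \<longleftrightarrow> (\<forall>\<phi>\<in>hom \<Gamma> (isometry_group m). \<exists>x\<in>mspace m. \<phi> g x = x)"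

definition always_fixed_point :: "'x metric \<Rightarrow> ('g, 'b) monoid_scheme \<Rightarrow> bool" where
  "always_fixed_point m \<Gamma> \<longleftrightarrow>
     (\<forall>\<phi>\<in>hom \<Gamma> (isometry_group m). \<exists>x\<in>mspace m. \<forall>g\<in>carrier \<Gamma>. \<phi> g x = x)"

lemma always_elliptic_hom:
  assumes "always_elliptic m \<Gamma> g" "\<psi> \<in> hom \<Gamma> \<Delta>"
  shows "always_elliptic m \<Delta> (\<psi> g)"
  unfolding always_elliptic_def
proof
  fix \<phi> assume "\<phi> \<in> hom \<Delta> (isometry_group m)"
  then have "\<phi> \<circ> \<psi> \<in> hom \<Gamma> (isometry_group m)" by (rule hom_compose[OF assms(2)])
  then show "\<exists>x\<in>mspace m. \<phi> (\<psi> g) x = x" using assms(1) unfolding always_elliptic_def by fastforce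
qed

lemma always_fixed_point_surj_hom:
  assumes "always_fixed_point m \<Gamma>" "\<psi> \<in> hom \<Gamma> \<Delta>" and surj: "carrier \<Delta> \<subseteq> \<psi> ` carrier \<Gamma>"
  shows "always_fixed_point m \<Delta>"
  unfolding always_fixed_point_def
proof
  fix \<phi> assume "\<phi> \<in> hom \<Delta> (isometry_group m)"
  then have "\<phi> \<circ> \<psi> \<in> hom \<Gamma> (isometry_group m)" by (rule hom_compose[OF assms(2)])
  then obtain x where "x \<in> mspace m" "\<forall>g\<in>carrier \<Gamma>. \<phi> (\<psi> g) x = x"
    using assms(1) unfolding always_fixed_point_def by fastforce
  then show "\<exists>x\<in>mspace m. \<forall>g\<in>carrier \<Delta>. \<phi> g x = x" using surj by blast
qed

lemma conj_swap_hom: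
  assumes ab: "a < n" "b < n"
  shows "(\<lambda>A. swaprows_mat n a b * A * swaprows_mat n a b) \<in> hom (GL_int n) (GL_int n)"
    and "(\<lambda>A. swaprows_mat n a b * A * swaprows_mat n a b) \<in> hom (SL_int n) (SL_int n)"
proof -
  interpret group "GL_int n" by (rule group_GL_int)
  let ?P = "swaprows_mat n a b :: int mat"
  have P: "?P \<in> carrier (GL_int n)" by (rule swaprows_mat_GL_int[OF ab])
  have PP: "?P * ?P = 1\<^sub>m n" by (rule swaprows_mat_inv[OF ab])
  have cl: "?P * A * ?P \<in> carrier (GL_int n)" if "A \<in> carrier (GL_int n)" for A
    using m_closed[OF m_closed[OF P that] P] by simp
  have mult: "?P * (A * B) * ?P = (?P * A * ?P) * (?P * B * ?P)"
    if "A \<in> carrier (GL_int n)" "B \<in> carrier (GL_int n)" for A B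
  proof -
    have AB: "A \<in> carrier_mat n n" "B \<in> carrier_mat n n" using that GL_int_carrier_mat by auto
    note cm = mult_carrier_mat[of _ n n _ n]
    have "(?P * A * ?P) * (?P * B * ?P) = ?P * (A * ((?P * ?P) * (B * ?P)))"
      using AB by (simp add: assoc_mult_mat[of _ n n _ n _ n] cm)
    also have "\<dots> = ?P * (A * B) * ?P"
      using AB by (simp add: PP assoc_mult_mat[of _ n n _ n _ n] cm)
    finally show ?thesis by simp
  qed
  have det: "det (?P * A * ?P) = det A" if "A \<in> carrier (GL_int n)" for A
  proof -
    have A: "A \<in> carrier_mat n n" using that by (rule GL_int_carrier_mat)
    have "det ?P * det ?P = 1" using det_mult[of ?P n ?P] PP by simp
    then have "det A * (det ?P * det ?P) = det A" by (simp only: mult_1_right)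
    moreover have "det (?P * A * ?P) = det ?P * det A * det ?P"
      using A det_mult[of "?P * A" n ?P] det_mult[of ?P n A] mult_carrier_mat[of ?P n n A n] by simp
    ultimately show ?thesis by (simp only: mult_ac)
  qed
  show "(\<lambda>A. ?P * A * ?P) \<in> hom (GL_int n) (GL_int n)"
    using cl mult by (auto simp: hom_def)
  show "(\<lambda>A. ?P * A * ?P) \<in> hom (SL_int n) (SL_int n)"
    using cl mult det by (auto simp: hom_def carrier_SL_int)
qed

lemma always_elliptic_elementary_all:
  assumes conj: "\<And>a b. a < n \<Longrightarrow> b < n \<Longrightarrow> (\<lambda>A. swaprows_mat n a b * A * swaprows_mat n a b) \<in> hom \<Gamma> \<Gamma>"
    and ell: "always_elliptic m \<Gamma> (elementary n k l)" and kl: "k < n" "l < n" "k \<noteq> l"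
    and ij: "i < n" "j < n" "i \<noteq> j"
  shows "always_elliptic m \<Gamma> (elementary n i j)"
proof -
  have swap: "always_elliptic m \<Gamma> (elementary n (transpose a b p) (transpose a b q))"
    if "a < n" "b < n" "p < n" "q < n" "p \<noteq> q" "always_elliptic m \<Gamma> (elementary n p q)" for a b p q
    using always_elliptic_hom[OF that(6) conj[OF that(1,2)]] swaprows_mat_conj_elementary[OF that(1-5)] by simp
  let ?l = "transpose k i l"
  have l: "?l < n" "?l \<noteq> i" using kl ij by (auto simp: Transposition.transpose_def)
  have "always_elliptic m \<Gamma> (elementary n i ?l)"
    using swap[OF kl(1) ij(1) kl ell] by simp
  from swap[OF l(1) ij(2) ij(1) l(1) _ this] l ij show ?thesis
    by (simp add: transpose_apply_other)
qed

text \<open>The \<open>n = d + 2\<close> reflections of the affine Coxeter group have a common fixed point by Helly's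
  theorem, since any \<open>d + 1\<close> of them lie in a finite group. So the whole group they generate fixes a
  point, although it is infinite; it contains a translation, and this is an elementary matrix.\<close>

lemma always_elliptic_elementary_GL_int:
  assumes m: "complete_CAT0 m" and dim: "covering_dim_le (mtopology_of m) d"
  shows "always_elliptic m (GL_int (Suc (Suc d))) (elementary (Suc (Suc d)) (Suc d) 0)"
  unfolding always_elliptic_def
proof
  fix \<phi>
  let ?n = "Suc (Suc d)"
  assume \<phi>: "\<phi> \<in> hom (GL_int ?n) (isometry_group m)"
  interpret CAT0_action m "GL_int ?n" \<phi>
    by (intro CAT0_action.intro CAT0_action_axioms.intro m group_GL_int \<phi>)
  have "fixset (\<Union>i\<le>Suc d. {reflection ?n i}) \<noteq> {}"
  proof (rule Helly_fixset)
    show "covering_dim_le mtopology d" using dim by (simp add: mtopology_of_eq)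
    show "{reflection ?n i} \<subseteq> carrier (GL_int ?n)" if "i \<le> Suc d" for i
      using reflection_GL_int[of ?n i] that by simp
    fix k assume k: "k \<le> Suc d"
    have "reflection ?n (if k = 0 then 1 else 0) \<in> vertex_stabilizer ?n k"
      using k by (intro reflection_in_vertex_stabilizer) auto
    then have "vertex_stabilizer ?n k \<noteq> {}" by blast
    moreover have "vertex_stabilizer ?n k \<subseteq> carrier (GL_int ?n)" by (auto simp: vertex_stabilizer_def)
    ultimately have "fixset (vertex_stabilizer ?n k) \<noteq> {}"
      by (intro finite_subgroup_has_fixed_point finite_vertex_stabilizer) (simp_all add: vertex_stabilizer_mult)
    then obtain x where "x \<in> fixset (vertex_stabilizer ?n k)" by blast
    moreover have "reflection ?n i \<in> vertex_stabilizer ?n k" if "i \<in> {..Suc d} - {k}" for i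
      using that k by (intro reflection_in_vertex_stabilizer) auto
    ultimately have "x \<in> fixset (\<Union>i\<in>{..Suc d} - {k}. {reflection ?n i})" by (auto simp: fixset_def)
    then show "fixset (\<Union>i\<in>{..Suc d} - {k}. {reflection ?n i}) \<noteq> {}" by blast
  qed
  then obtain x where x: "x \<in> mspace m" and fix_refl: "\<And>i. i < ?n \<Longrightarrow> \<phi> (reflection ?n i) x = x"
    by (auto simp: fixset_def less_Suc_eq_le)
  define H where "H = {g \<in> carrier (GL_int ?n). \<phi> g x = x}"
  have H_iff: "g \<in> H \<longleftrightarrow> g \<in> carrier (GL_int ?n) \<and> \<phi> g x = x" for g by (simp add: H_def)
  interpret H: subgroup H "GL_int ?n" unfolding H_def by (rule stabilizer_subgroup[OF x])
  have refl: "reflection ?n i \<in> H" if "i < ?n" for i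
    unfolding H_iff using fix_refl[OF that] reflection_GL_int[of ?n i] that by simp
  have sign: "multrow_mat ?n j (-1) \<in> H" if "1 \<le> j" "j < ?n" for j
    using that
  proof (induction j rule: nat_induct_at_least)
    case base
    then show ?case using refl[of 0] by (simp add: reflection_def)
  next
    case (Suc j)
    let ?s = "swaprows_mat ?n j (Suc j) :: int mat" and ?M = "multrow_mat ?n j (-1) :: int mat"
    have "?s \<in> H" using refl[of j] Suc by (simp add: reflection_def)
    moreover have "?M \<in> H" using Suc by simp
    ultimately have "?s * (?M * ?s) \<in> H" using H.m_closed[of ?s "?M * ?s"] H.m_closed[of ?M ?s] by simp
    moreover have "?s * (?M * ?s) = multrow_mat ?n (Suc j) (-1)"
    proof -
      have "?s * (?M * ?s) = swaprows j (Suc j) (multrow j (-1) ?s)"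
        using swaprows_mat[of "?M * ?s" ?n ?n j "Suc j"] multrow_mat[of ?s ?n ?n j "-1"] Suc.prems
        by (simp add: mult_carrier_mat[OF multrow_mat_carrier swaprows_mat_carrier])
      also have "\<dots> = multrow_mat ?n (Suc j) (-1)" using Suc.prems by (intro eq_matI) auto
      finally show ?thesis .
    qed
    ultimately show ?case by simp
  qed
  let ?M = "multrow_mat ?n (Suc d) (-1) :: int mat"
  have "elementary ?n (Suc d) 0 * ?M \<in> H" using refl[of "Suc d"] by (simp add: reflection_def)
  then have "elementary ?n (Suc d) 0 * ?M * ?M \<in> H"
    using H.m_closed[of "elementary ?n (Suc d) 0 * ?M" ?M] sign[of "Suc d"] by simp
  moreover have "?M * ?M = 1\<^sub>m ?n"
    unfolding multrow_mat[OF multrow_mat_carrier, symmetric] by (intro eq_matI) auto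
  then have "elementary ?n (Suc d) 0 * ?M * ?M = elementary ?n (Suc d) 0"
    by (subst assoc_mult_mat[OF addrow_mat_carrier multrow_mat_carrier multrow_mat_carrier]) simp
  ultimately have "elementary ?n (Suc d) 0 \<in> H" by simp
  then show "\<exists>x\<in>mspace m. \<phi> (elementary ?n (Suc d) 0) x = x" using x H_iff by blast
qed

section \<open>Fixed points of unipotent groups, SL(n,Z) and GL(n,Z)\<close>

text \<open>The elementary matrices whose indices increase with respect to \<open>r\<close> generate a nilpotent group.
  They are added one at a time, those with the largest difference \<open>r j - r i\<close> first. As commutators only
  produce larger differences, each new matrix preserves the fixed point set of the previous ones, so that
  its own fixed points can be projected there.\<close>

lemma fixed_point_unipotent:
  fixes r :: "nat \<Rightarrow> nat"
  assumes act: "CAT0_action m (SL_int n) \<phi>"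
    and ell: "\<And>i j. \<lbrakk>i < n; j < n; i \<noteq> j\<rbrakk> \<Longrightarrow> \<exists>x\<in>mspace m. \<phi> (elementary n i j) x = x"
  shows "\<exists>x\<in>mspace m. \<forall>i<n. \<forall>j<n. r i < r j \<longrightarrow> \<phi> (elementary n i j) x = x"
proof -
  interpret CAT0_action m "SL_int n" \<phi> by (rule act)
  let ?E = "\<lambda>(i,j). elementary n i j" and ?h = "\<lambda>(i,j). r j - r i"
  let ?pos = "{(i,j). i < n \<and> j < n \<and> r i < r j}"
  have fin: "finite ?pos" by (rule finite_subset[of _ "{..<n} \<times> {..<n}"]) auto
  have EC: "addrow_mat n a i j \<in> carrier (SL_int n)" if "i < n" "j < n" "i \<noteq> j" for i j a
    using that by (rule addrow_mat_SL_int)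
  have "fixset (?E ` S) \<noteq> {}"
    if "S \<subseteq> ?pos" and "\<And>p q. p \<in> S \<Longrightarrow> q \<in> ?pos \<Longrightarrow> ?h p < ?h q \<Longrightarrow> q \<in> S" for S
    using that
  proof (induction "card S" arbitrary: S rule: less_induct)
    case less
    have finS: "finite S" using less.prems(1) fin finite_subset by blast
    show ?case
    proof (cases "S = {}")
      case True
      then show ?thesis using nonempty by (auto simp: fixset_def)
    next
      case False
      then obtain p where pS: "p \<in> S" and least: "\<And>q. q \<in> S \<Longrightarrow> ?h p \<le> ?h q"
        using ex_has_least_nat[of "\<lambda>p. p \<in> S" _ ?h] by blast
      obtain i j where p: "p = (i,j)" by (cases p)
      have ij: "i < n" "j < n" "r i < r j" using pS p less.prems(1) by auto
      let ?S = "S - {p}"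
      have up: "q \<in> ?S" if "q' \<in> S" "q \<in> ?pos" "?h q' < ?h q" for q q'
        using less.prems(2)[OF that] least[OF that(1)] that(3) by auto
      have IH: "fixset (?E ` ?S) \<noteq> {}"
      proof (rule less.hyps)
        show "card ?S < card S" using finS pS by (rule card_Diff1_less)
        show "?S \<subseteq> ?pos" using less.prems(1) by blast
        show "q \<in> ?S" if "q' \<in> ?S" "q \<in> ?pos" "?h q' < ?h q" for q' q
          using up[of q' q] that by blast
      qed
      have "fixset (insert (elementary n i j) (?E ` ?S)) \<noteq> {}"
      proof (rule fixset_insert_normalizing[OF _ _ IH])
        show "?E ` ?S \<subseteq> carrier (SL_int n)" using less.prems(1) EC by fastforce
        show Eij: "elementary n i j \<in> carrier (SL_int n)" using EC ij by blast
        show "fixset {elementary n i j} \<noteq> {}" using ell[of i j] ij by (auto simp: fixset_def)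
        fix s x assume s: "s \<in> ?E ` ?S" and x: "x \<in> fixset (?E ` ?S)"
        then obtain k l where kl: "(k,l) \<in> ?S" and s_def: "s = elementary n k l" by auto
        have klS: "(k,l) \<in> S" using kl by simp
        have kl': "k < n" "l < n" "r k < r l" using klS less.prems(1) by auto
        have xX: "x \<in> mspace m" using x by (simp add: fixset_def)
        have fixE: "\<phi> (elementary n a b) x = x" if "(a,b) \<in> ?S" for a b
          using x that unfolding fixset_def by force
        consider "l = i" | "k = j" "l \<noteq> i" | "l \<noteq> i" "k \<noteq> j" by blast
        then have "\<exists>u\<in>carrier (SL_int n). s * elementary n i j = elementary n i j * u \<and> \<phi> u x = x"
        proof cases
          case 1
          have ne: "i \<noteq> j" "k \<noteq> i" "k \<noteq> j" using ij kl' 1 by auto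
          have "(k,j) \<in> ?S" using up[OF klS, of "(k,j)"] kl' ij 1 by auto
          then have "\<phi> (elementary n k i * elementary n k j) x = x"
            using action_mult[OF EC EC xX, of k i k j 1 1] fixE kl ne kl' ij 1 by simp
          moreover have "elementary n k i * elementary n k j \<in> carrier (SL_int n)"
            using m_closed[OF EC EC, of k i k j 1 1] ne kl' ij by simp
          moreover have "s * elementary n i j = elementary n i j * (elementary n k i * elementary n k j)"
            using elementary_mult_right[of k n i j] ne kl' ij by (simp add: s_def 1)
          ultimately show ?thesis by blast
        next
          case 2
          have ne: "i \<noteq> j" "l \<noteq> i" "l \<noteq> j" using ij kl' 2 by auto
          have "(i,l) \<in> ?S" using up[OF klS, of "(i,l)"] kl' ij 2 by auto
          then have il: "\<phi> (elementary n i l) x = x" by (rule fixE)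
          have "addrow_mat n (-1) i l * elementary n i l = 1\<^sub>m n"
            using addrow_mat_inv[of i n l "-1::int"] ij kl' ne by simp
          then have "\<phi> (addrow_mat n (-1) i l) x = x"
            using action_mult[OF EC EC xX, of i l i l "-1" 1] il action_one[OF xX] ne ij kl' by simp
          then have "\<phi> (elementary n j l * addrow_mat n (-1) i l) x = x"
            using action_mult[OF EC EC xX, of j l i l 1 "-1"] fixE kl ne kl' ij 2 by simp
          moreover have "elementary n j l * addrow_mat n (-1) i l \<in> carrier (SL_int n)"
            using m_closed[OF EC EC, of j l i l 1 "-1"] ne kl' ij by simp
          moreover have "s * elementary n i j = elementary n i j * (elementary n j l * addrow_mat n (-1) i l)"
            using elementary_mult_left[of l n i j] ne kl' ij by (simp add: s_def 2)
          ultimately show ?thesis by blast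
        next
          case 3
          have ne: "i \<noteq> j" "k \<noteq> l" using ij kl' by auto
          show ?thesis
            using elementary_commute[of i n j k l] ne 3 ij kl' fixE[OF kl] EC[of k l 1]
            by (auto simp: s_def)
        qed
        then obtain u where u: "u \<in> carrier (SL_int n)" "s * elementary n i j = elementary n i j * u" "\<phi> u x = x"
          by blast
        then show "\<phi> (s \<otimes>\<^bsub>SL_int n\<^esub> elementary n i j) x = \<phi> (elementary n i j) x"
          using action_mult[OF Eij u(1) xX] by simp
      qed
      moreover have "insert (elementary n i j) (?E ` ?S) = ?E ` S" using pS p by auto
      ultimately show ?thesis by simp
    qed
  qed
  from this[of ?pos] have "fixset (?E ` ?pos) \<noteq> {}" by blast
  then obtain x where "x \<in> fixset (?E ` ?pos)" by blast
  then show ?thesis by (intro bexI[of _ x]) (auto simp: fixset_def)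
qed

text \<open>The \<open>n = d + 2\<close> elementary matrices along the cycle \<open>0, 1, \<dots>, n - 1, 0\<close> generate SL(n,Z). Cutting
  the cycle after \<open>k\<close> leaves a linear order, so all of them but one lie in a unipotent group and have a
  common fixed point. Helly's theorem gives a common fixed point of all of them.\<close>

lemma SL_int_fixed_point:
  assumes act: "CAT0_action m (SL_int (Suc (Suc d))) \<phi>" and dim: "covering_dim_le (mtopology_of m) d"
    and ell: "\<And>i j. \<lbrakk>i < Suc (Suc d); j < Suc (Suc d); i \<noteq> j\<rbrakk> \<Longrightarrow>
      \<exists>x\<in>mspace m. \<phi> (elementary (Suc (Suc d)) i j) x = x"
  shows "\<exists>x\<in>mspace m. \<forall>A\<in>carrier (SL_int (Suc (Suc d))). \<phi> A x = x"
proof -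
  let ?n = "Suc (Suc d)"
  interpret CAT0_action m "SL_int ?n" \<phi> by (rule act)
  define nxt where "nxt i = (if i = Suc d then 0 else Suc i)" for i
  let ?A = "\<lambda>i. {elementary ?n i (nxt i)}"
  have "fixset (\<Union>i\<le>Suc d. ?A i) \<noteq> {}"
  proof (rule Helly_fixset)
    show "covering_dim_le mtopology d" using dim by (simp add: mtopology_of_eq)
    show "?A i \<subseteq> carrier (SL_int ?n)" if "i \<le> Suc d" for i
      using that addrow_mat_SL_int[of i ?n "nxt i" 1] by (auto simp: nxt_def)
    fix k assume k: "k \<le> Suc d"
    \<comment> \<open>the linear order \<open>k + 1, \<dots>, n - 1, 0, \<dots>, k\<close> left when the cycle is cut after \<open>k\<close>\<close>
    define r where "r i = (if i \<le> k then i + ?n else i)" for i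
    obtain x where x: "x \<in> mspace m"
      and fx: "\<And>i j. i < ?n \<Longrightarrow> j < ?n \<Longrightarrow> r i < r j \<Longrightarrow> \<phi> (elementary ?n i j) x = x"
      using fixed_point_unipotent[OF act ell, of r] by blast
    have "\<phi> (elementary ?n i (nxt i)) x = x" if "i \<in> {..Suc d} - {k}" for i
      using that k by (intro fx) (auto simp: nxt_def r_def)
    then have "x \<in> fixset (\<Union>i\<in>{..Suc d} - {k}. ?A i)" using x by (auto simp: fixset_def)
    then show "fixset (\<Union>i\<in>{..Suc d} - {k}. ?A i) \<noteq> {}" by blast
  qed
  then obtain x where x: "x \<in> mspace m" and fx: "\<And>i. i \<le> Suc d \<Longrightarrow> \<phi> (elementary ?n i (nxt i)) x = x"
    by (auto simp: fixset_def)
  have "carrier (SL_int ?n) \<subseteq> {g \<in> carrier (SL_int ?n). \<phi> g x = x}"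
  proof (rule SL_int_subgroup_eq[OF stabilizer_subgroup[OF x]])
    show "elementary ?n i (Suc i) \<in> {g \<in> carrier (SL_int ?n). \<phi> g x = x}" if "Suc i < ?n" for i
      using fx[of i] that addrow_mat_SL_int[of i ?n "Suc i" 1] by (simp add: nxt_def)
    show "elementary ?n (?n - 1) 0 \<in> {g \<in> carrier (SL_int ?n). \<phi> g x = x}"
      using fx[of "Suc d"] addrow_mat_SL_int[of "Suc d" ?n 0 1] by (simp add: nxt_def)
  qed simp
  then show ?thesis using x by blast
qed

text \<open>SL(n,Z) has index two in GL(n,Z), and the other coset is represented by the involution
  \<open>diag(-1,1,\<dots>,1)\<close>, which has a fixed point of its own and normalizes SL(n,Z).\<close>

lemma always_fixed_point_GL_int:
  assumes m: "complete_CAT0 m" and dim: "covering_dim_le (mtopology_of m) d"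
  shows "always_fixed_point m (GL_int (Suc (Suc d)))"
  unfolding always_fixed_point_def
proof
  fix \<phi>
  let ?n = "Suc (Suc d)"
  assume \<phi>: "\<phi> \<in> hom (GL_int ?n) (isometry_group m)"
  interpret CAT0_action m "GL_int ?n" \<phi>
    by (intro CAT0_action.intro CAT0_action_axioms.intro m group_GL_int \<phi>)
  have "\<phi> \<in> hom (SL_int ?n) (isometry_group m)"
    using Group.hom_compose[OF SL_int_inclusion_hom \<phi>] by (simp add: o_def)
  then have act: "CAT0_action m (SL_int ?n) \<phi>"
    by (intro CAT0_action.intro CAT0_action_axioms.intro m group_SL_int)
  have "always_elliptic m (GL_int ?n) (elementary ?n i j)" if "i < ?n" "j < ?n" "i \<noteq> j" for i j
    using always_elliptic_elementary_all[OF conj_swap_hom(1) always_elliptic_elementary_GL_int[OF m dim] _ _ _ that]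
    by simp
  then obtain x where x: "x \<in> mspace m" "\<And>A. A \<in> carrier (SL_int ?n) \<Longrightarrow> \<phi> A x = x"
    using SL_int_fixed_point[OF act dim] \<phi> unfolding always_elliptic_def by blast
  let ?D = "multrow_mat ?n 0 (-1) :: int mat"
  have D: "?D \<in> carrier (GL_int ?n)" by (rule multrow_mat_GL_int) simp
  have DD: "?D * ?D = 1\<^sub>m ?n"
    unfolding multrow_mat[OF multrow_mat_carrier, symmetric] by (intro eq_matI) auto
  have detD: "det ?D = -1" by (rule det_multrow_mat) simp
  have DA: "?D * A \<in> carrier (GL_int ?n)" "det (?D * A) = - det A" "?D * (?D * A) = A"
    if A: "A \<in> carrier (GL_int ?n)" for A
  proof -
    have Ac: "A \<in> carrier_mat ?n ?n" using A by (rule GL_int_carrier_mat)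
    show "?D * A \<in> carrier (GL_int ?n)" using m_closed[OF D A] by simp
    show "det (?D * A) = - det A" using det_mult[OF multrow_mat_carrier Ac] detD by simp
    show "?D * (?D * A) = A"
      using assoc_mult_mat[OF multrow_mat_carrier multrow_mat_carrier Ac, symmetric] DD Ac by simp
  qed
  have "fixset (insert ?D (carrier (SL_int ?n))) \<noteq> {}"
  proof (rule fixset_insert_normalizing[OF _ D])
    show "carrier (SL_int ?n) \<subseteq> carrier (GL_int ?n)" by (auto simp: carrier_SL_int)
    show "fixset (carrier (SL_int ?n)) \<noteq> {}" using x by (auto simp: fixset_def)
    have "fixset {1\<^sub>m ?n, ?D} \<noteq> {}"
      using D DD one_closed by (intro finite_subgroup_has_fixed_point) auto
    then show "fixset {?D} \<noteq> {}" by (auto simp: fixset_def)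
    fix s x assume s: "s \<in> carrier (SL_int ?n)" and x: "x \<in> fixset (carrier (SL_int ?n))"
    have sG: "s \<in> carrier (GL_int ?n)" and sdet: "det s = 1" using s by (auto simp: carrier_SL_int)
    have sD: "s * ?D \<in> carrier (GL_int ?n)" using m_closed[OF sG D] by simp
    have "det (s * ?D) = -1" using det_mult[OF GL_int_carrier_mat[OF sG] multrow_mat_carrier] sdet detD by simp
    then have u: "?D * (s * ?D) \<in> carrier (SL_int ?n)" using DA[OF sD] by (simp add: carrier_SL_int)
    then have "\<phi> (?D * (s * ?D)) x = x" using x by (simp add: fixset_def)
    moreover have "\<phi> (?D * (?D * (s * ?D))) x = \<phi> ?D (\<phi> (?D * (s * ?D)) x)"
      using action_mult[OF D DA(1)[OF sD]] x by (simp add: fixset_def)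
    ultimately show "\<phi> (s \<otimes>\<^bsub>GL_int ?n\<^esub> ?D) x = \<phi> ?D x" using DA(3)[OF sD] by simp
  qed
  then obtain y where y: "y \<in> mspace m" "\<phi> ?D y = y" "\<And>A. A \<in> carrier (SL_int ?n) \<Longrightarrow> \<phi> A y = y"
    by (auto simp: fixset_def)
  have "\<phi> A y = y" if A: "A \<in> carrier (GL_int ?n)" for A
  proof (cases "det A = 1")
    case True
    then show ?thesis using y A by (simp add: carrier_SL_int)
  next
    case False
    then have "?D * A \<in> carrier (SL_int ?n)" using det_GL_int[OF A] DA[OF A] by (auto simp: carrier_SL_int)
    then show ?thesis using y action_mult[OF D DA(1)[OF A] y(1)] DA(3)[OF A] by simp
  qed
  then show "\<exists>x\<in>mspace m. \<forall>g\<in>carrier (GL_int ?n). \<phi> g x = x" using y by blast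
qed

section \<open>Homomorphisms from GL to SL\<close>

text \<open>For odd \<open>n\<close>, GL(n,Z) is the direct product of SL(n,Z) and \<open>{1,-1}\<close>; this is the projection to the
  first factor.\<close>

lemma det_smult_hom:
  assumes "odd n"
  shows "(\<lambda>A. det A \<cdot>\<^sub>m A) \<in> hom (GL_int n) (SL_int n)"
proof -
  have cl: "det A \<cdot>\<^sub>m A \<in> carrier (SL_int n)" if A: "A \<in> carrier (GL_int n)" for A
  proof -
    obtain B where B: "A \<in> carrier_mat n n" "B \<in> carrier_mat n n" "B * A = 1\<^sub>m n" "A * B = 1\<^sub>m n"
      using A by (auto simp: carrier_GL_int_iff)
    have dd: "det A * det A = 1" using det_GL_int[OF A] by auto
    have "det (det A \<cdot>\<^sub>m A) = det A ^ Suc n" using B by (simp add: det_smult)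
    also have "\<dots> = 1" using det_GL_int[OF A] assms by auto
    finally have det1: "det (det A \<cdot>\<^sub>m A) = 1" .
    have smult: "(det A \<cdot>\<^sub>m C) * (det A \<cdot>\<^sub>m D) = 1\<^sub>m n"
      if "C \<in> carrier_mat n n" "D \<in> carrier_mat n n" "C * D = 1\<^sub>m n" for C D
    proof -
      have "(det A \<cdot>\<^sub>m C) * (det A \<cdot>\<^sub>m D) = det A \<cdot>\<^sub>m (C * (det A \<cdot>\<^sub>m D))"
        using that by (intro mult_smult_assoc_mat[of _ n n _ n]) auto
      also have "C * (det A \<cdot>\<^sub>m D) = det A \<cdot>\<^sub>m (C * D)"
        using that by (intro mult_smult_distrib[of _ n n _ n]) auto
      finally have "(det A \<cdot>\<^sub>m C) * (det A \<cdot>\<^sub>m D) = det A \<cdot>\<^sub>m (det A \<cdot>\<^sub>m 1\<^sub>m n)"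
        using that(3) by simp
      also have "\<dots> = 1\<^sub>m n" using dd by (intro eq_matI) auto
      finally show ?thesis .
    qed
    have "(det A \<cdot>\<^sub>m B) * (det A \<cdot>\<^sub>m A) = 1\<^sub>m n" "(det A \<cdot>\<^sub>m A) * (det A \<cdot>\<^sub>m B) = 1\<^sub>m n"
      using smult[OF B(2,1,3)] smult[OF B(1,2,4)] .
    then show ?thesis using B det1
      by (auto simp: carrier_SL_int carrier_GL_int_iff intro!: bexI[of _ "det A \<cdot>\<^sub>m B"])
  qed
  moreover have "det (A * B) \<cdot>\<^sub>m (A * B) = (det A \<cdot>\<^sub>m A) * (det B \<cdot>\<^sub>m B)"
    if "A \<in> carrier (GL_int n)" "B \<in> carrier (GL_int n)" for A B
  proof -
    have AB: "A \<in> carrier_mat n n" "B \<in> carrier_mat n n" using that GL_int_carrier_mat by auto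
    have "(det A \<cdot>\<^sub>m A) * (det B \<cdot>\<^sub>m B) = det A \<cdot>\<^sub>m (A * (det B \<cdot>\<^sub>m B))"
      using AB by (intro mult_smult_assoc_mat[of _ n n _ n]) auto
    also have "A * (det B \<cdot>\<^sub>m B) = det B \<cdot>\<^sub>m (A * B)"
      using AB by (intro mult_smult_distrib[of _ n n _ n]) auto
    also have "det A \<cdot>\<^sub>m (det B \<cdot>\<^sub>m (A * B)) = det (A * B) \<cdot>\<^sub>m (A * B)"
      using AB by (intro eq_matI) (simp_all add: det_mult[of A n B])
    finally show ?thesis by simp
  qed
  ultimately show ?thesis by (auto simp: hom_def)
qed

definition corner_block :: "nat \<Rightarrow> int mat \<Rightarrow> int mat" where
  "corner_block n A = four_block_mat A (0\<^sub>m n 1) (0\<^sub>m 1 n) (mat 1 1 (\<lambda>_. det A))"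

lemma corner_block_mult:
  assumes "A \<in> carrier_mat n n" "B \<in> carrier_mat n n"
  shows "corner_block n (A * B) = corner_block n A * corner_block n B"
proof -
  have "mat 1 1 (\<lambda>_. det A) * mat 1 1 (\<lambda>_. det B) = mat 1 1 (\<lambda>_. det (A * B))"
    using assms by (intro eq_matI) (auto simp: det_mult scalar_prod_def)
  then show ?thesis unfolding corner_block_def
    using assms by (subst mult_four_block_mat[of _ n n _ 1 _ 1 _ _ n _ 1]) auto
qed

lemma corner_block_hom: "corner_block n \<in> hom (GL_int n) (SL_int (Suc n))"
proof -
  have one: "corner_block n (1\<^sub>m n) = 1\<^sub>m (Suc n)"
    unfolding corner_block_def by (intro eq_matI) auto
  have cc: "corner_block n A \<in> carrier_mat (Suc n) (Suc n)" if "A \<in> carrier_mat n n" for A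
    using that four_block_carrier_mat[of A n n "mat 1 1 (\<lambda>_. det A)" 1 1] by (simp add: corner_block_def)
  have "corner_block n A \<in> carrier (SL_int (Suc n))" if A: "A \<in> carrier (GL_int n)" for A
  proof -
    obtain B where B: "A \<in> carrier_mat n n" "B \<in> carrier_mat n n" "B * A = 1\<^sub>m n" "A * B = 1\<^sub>m n"
      using A by (auto simp: carrier_GL_int_iff)
    have "corner_block n B * corner_block n A = 1\<^sub>m (Suc n)" "corner_block n A * corner_block n B = 1\<^sub>m (Suc n)"
      using corner_block_mult[of B n A] corner_block_mult[of A n B] B one by auto
    moreover have "det (corner_block n A) = det A * det (mat 1 1 (\<lambda>_. det A))"
      unfolding corner_block_def using B by (intro det_four_block_mat_lower_left_zero[of _ n _ 1]) auto
    then have "det (corner_block n A) = 1"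
      using det_GL_int[OF A] by (auto simp: det_single)
    ultimately show ?thesis using B cc
      by (auto simp: carrier_SL_int carrier_GL_int_iff)
  qed
  then show ?thesis using corner_block_mult GL_int_carrier_mat by (auto simp: hom_def)
qed

lemma corner_block_elementary:
  assumes "i < n" "j < n" "i \<noteq> j"
  shows "corner_block n (elementary n i j) = elementary (Suc n) i j"
proof -
  have "det (elementary n i j) = 1" using det_addrow_mat assms(3) by blast
  then show ?thesis unfolding corner_block_def using assms by (intro eq_matI) auto
qed

lemma always_fixed_point_SL_int_odd:
  assumes m: "complete_CAT0 m" and dim: "covering_dim_le (mtopology_of m) d" and odd: "odd d"
  shows "always_fixed_point m (SL_int (Suc (Suc d)))"
proof (rule always_fixed_point_surj_hom[OF always_fixed_point_GL_int[OF m dim] det_smult_hom])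
  show "odd (Suc (Suc d))" using odd by simp
  show "carrier (SL_int (Suc (Suc d))) \<subseteq> (\<lambda>A. det A \<cdot>\<^sub>m A) ` carrier (GL_int (Suc (Suc d)))"
  proof
    fix A assume "A \<in> carrier (SL_int (Suc (Suc d)))"
    then have "A = det A \<cdot>\<^sub>m A" "A \<in> carrier (GL_int (Suc (Suc d)))" by (auto simp: carrier_SL_int)
    then show "A \<in> (\<lambda>A. det A \<cdot>\<^sub>m A) ` carrier (GL_int (Suc (Suc d)))" by blast
  qed
qed

text \<open>Here the size of the matrices is \<open>d + 3\<close>, one more than in the results above: the elementary
  matrices are known to be elliptic only through the copy of GL(d+2,Z) in SL(d+3,Z) given by
  \<open>A \<mapsto> diag(A, det A)\<close>.\<close>

lemma always_fixed_point_SL_int: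
  assumes m: "complete_CAT0 m" and dim: "covering_dim_le (mtopology_of m) d"
  shows "always_fixed_point m (SL_int (Suc (Suc (Suc d))))"
  unfolding always_fixed_point_def
proof
  fix \<phi>
  let ?n = "Suc (Suc (Suc d))"
  assume \<phi>: "\<phi> \<in> hom (SL_int ?n) (isometry_group m)"
  have act: "CAT0_action m (SL_int ?n) \<phi>"
    by (intro CAT0_action.intro CAT0_action_axioms.intro m group_SL_int \<phi>)
  have "always_elliptic m (SL_int ?n) (elementary ?n (Suc d) 0)"
    using always_elliptic_hom[OF always_elliptic_elementary_GL_int[OF m dim] corner_block_hom]
    by (simp add: corner_block_elementary)
  then have "always_elliptic m (SL_int ?n) (elementary ?n i j)" if "i < ?n" "j < ?n" "i \<noteq> j" for i j
    using always_elliptic_elementary_all[OF conj_swap_hom(2) _ _ _ _ that] by fastforce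
  then have "\<exists>x\<in>mspace m. \<phi> (elementary ?n i j) x = x" if "i < ?n" "j < ?n" "i \<noteq> j" for i j
    using \<phi> that unfolding always_elliptic_def by blast
  then show "\<exists>x\<in>mspace m. \<forall>A\<in>carrier (SL_int ?n). \<phi> A x = x"
    by (intro SL_int_fixed_point[OF act covering_dim_le_mono[OF dim]]) auto
qed

section \<open>The bounds on FixDim\<close>

lemma FixDim_ge:
  assumes fp: "\<And>(m :: 'x metric) d. \<lbrakk>complete_CAT0 m; covering_dim_le (mtopology_of m) d; d + 2 \<le> k\<rbrakk>
    \<Longrightarrow> always_fixed_point m \<Gamma>"
  shows "FixDim TYPE('x) \<Gamma> \<ge> ereal (real k - 2)"
proof -
  have "real k - 2 \<le> real d - 1" if hd: "has_fixed_point_free_action_dim TYPE('x) \<Gamma> d" for d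
  proof (rule ccontr)
    assume "\<not> ?thesis"
    then have "real (Suc d) < real k" by simp
    then have "d + 2 \<le> k" by (simp only: of_nat_less_iff)
    moreover obtain m :: "'x metric" and \<phi> where "CAT0_space m" "mcomplete_of m"
      "covering_dim_le (mtopology_of m) d" "fixed_point_free_action \<Gamma> m \<phi>"
      using hd unfolding has_fixed_point_free_action_dim_def has_covering_dim_def by blast
    ultimately show False
      using fp[of m d] unfolding fixed_point_free_action_def always_fixed_point_def complete_CAT0_def by blast
  qed
  then show ?thesis unfolding FixDim_def by (auto intro: LeastI2_ex)
qed

theorem proposition9p4:
  fixes n :: nat
  assumes "n \<ge> 1"
  shows "FixDim TYPE('x) (GL_int n) \<ge> ereal (real n - 2) \<and>
    (odd n \<longrightarrow> FixDim TYPE('x) (SL_int n) \<ge> ereal (real n - 2)) \<and>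
    (even n \<longrightarrow> FixDim TYPE('x) (SL_int n) \<ge> ereal (real n - 3))"
proof (intro conjI impI)
  have dim: "covering_dim_le X (k - 2) \<and> k = Suc (Suc (k - 2))"
    if "covering_dim_le X d" "d + 2 \<le> k" for X :: "'x topology" and d k
    using that by (auto intro: covering_dim_le_mono)
  show "FixDim TYPE('x) (GL_int n) \<ge> ereal (real n - 2)"
  proof (rule FixDim_ge)
    fix m :: "'x metric" and d
    assume m: "complete_CAT0 m" and "covering_dim_le (mtopology_of m) d" "d + 2 \<le> n"
    with dim show "always_fixed_point m (GL_int n)"
      using always_fixed_point_GL_int[OF m, of "n - 2"] by metis
  qed
  show "FixDim TYPE('x) (SL_int n) \<ge> ereal (real n - 2)" if "odd n"
  proof (rule FixDim_ge)
    fix m :: "'x metric" and d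
    assume m: "complete_CAT0 m" and "covering_dim_le (mtopology_of m) d" "d + 2 \<le> n"
    with dim that show "always_fixed_point m (SL_int n)"
      using always_fixed_point_SL_int_odd[OF m, of "n - 2"] by (metis even_Suc)
  qed
  show "FixDim TYPE('x) (SL_int n) \<ge> ereal (real n - 3)" if "even n"
  proof -
    have "FixDim TYPE('x) (SL_int n) \<ge> ereal (real (n - 1) - 2)"
    proof (rule FixDim_ge)
      fix m :: "'x metric" and d
      assume m: "complete_CAT0 m" and d: "covering_dim_le (mtopology_of m) d" "d + 2 \<le> n - 1"
      then have "covering_dim_le (mtopology_of m) (n - 3)" "n = Suc (Suc (Suc (n - 3)))"
        by (auto intro: covering_dim_le_mono)
      then show "always_fixed_point m (SL_int n)"
        using always_fixed_point_SL_int[OF m, of "n - 3"] by metis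
    qed
    then show ?thesis using assms by (simp add: of_nat_diff)
  qed
qed

end
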